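(* Let $f(\zeta,t)$ be a locally univalent solution of the Polubarinova-Galin equation with $g=f'$ rational, $$g(\zeta,t)=b(t)\frac{\prod_{k=1}^{m}(\zeta-\omega_k(t))}{\prod_{j=1}^{n}(\zeta-\zeta_j(t))},\qquad m\ge n,$$ and assume that the zeros $\omega_1,\dots,\omega_m$ of $g$ are simple. Then $$-\frac{d}{dt}\log\omega_k=A_0+\frac{2A_k}{\omega_k}+\sum_{j=1,\,j\ne k}^m\frac{2(A_k+A_j)}{\omega_k-\omega_j}-\sum_{j=1}^n\frac{2A_k}{\omega_k-\zeta_j}\qquad(1\le k\le m),$$ $$-\frac{d}{dt}\log\zeta_j=A_0+\sum_{k=1}^m\frac{2A_k}{\zeta_j-\omega_k}\qquad(1\le j\le n),$$ $$\frac{d\log b}{dt}=(m-n+1)A_0,$$ where $$A_k=\frac{q}{|b|^2}\cdot\frac{\prod_{j=1}^n(\omega_k-\zeta_j)\prod_{j=1}^n\overline{(\omega_k^*-\zeta_j)}}{\prod_{j\ne k}(\omega_k-\omega_j)\prod_{j=1}^m\overline{(\omega_k^*-\omega_j)}}\quad(1\le k\le m),\qquad A_0=A_\infty+\sum_{j=1}^m\frac{A_j}{\omega_j},$$ and $A_\infty=\dfrac{q}{b\,a_1}$ if $m=n$, $A_\infty=0$ if $m>n$, with $a_1(t)=g(0,t)>0$.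
   Context: Notation: $\mathbb{D}$ is the open unit disk; dot denotes $\partial/\partial t$, prime denotes $\partial/\partial\zeta$; $\omega^*=1/\overline{\omega}$ for a point $\omega$. Locally univalent solution: for $t$ in a time interval, $f(\cdot,t)$ is analytic in a neighborhood of $\overline{\mathbb{D}}$, $f(0,t)=0$, $f'(0,t)>0$, $f'(\zeta,t)\neq0$ for $\zeta\in\overline{\mathbb{D}}$, $f$ depends smoothly on $t$, and $\operatorname{Re}[\dot f(\zeta,t)\overline{\zeta f'(\zeta,t)}]=q(t)$ for $\zeta\in\partial\mathbb{D}$, where $q$ is a given real-valued continuous function. Form of $g=f'$: $b(t)\neq0$, $|\omega_k|>1$, $|\zeta_j|>1$, no zero coincides with a pole; poles are repeated according to multiplicity; $m,n$ are fixed on the time interval considered. Equivalent descriptions: $A_k=q/(g'(\omega_k,t)g^*(\omega_k,t))$, where $g^*(\zeta,t)=\overline{g(1/\bar\zeta,t)}$, and $A_\infty=\lim_{\zeta\to\infty}q/(g(\zeta,t)g^*(\zeta,t))$. *)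

theory Defs
  imports "HOL-Analysis.Analysis"
begin

text \<open>
  A time-dependent function \<open>f(z,t)\<close> is a curried function \<open>f :: complex \<Rightarrow> real \<Rightarrow> complex\<close>.
  Time derivatives are taken within the time interval \<open>I\<close>, so they are one-sided at those end
  points of \<open>I\<close> that belong to \<open>I\<close>.
\<close>

abbreviation space_deriv :: "(complex \<Rightarrow> real \<Rightarrow> complex) \<Rightarrow> complex \<Rightarrow> real \<Rightarrow> complex" where
  "space_deriv f z t \<equiv> deriv (\<lambda>w. f w t) z"

abbreviation time_deriv :: "real set \<Rightarrow> (complex \<Rightarrow> real \<Rightarrow> complex) \<Rightarrow> complex \<Rightarrow> real \<Rightarrow> complex" where
  "time_deriv I f z t \<equiv> vector_derivative (f z) (at t within I)"

text \<open>
  Smooth dependence on time means \<open>C\<^sup>1\<close>: since \<open>q\<close> is only required to be continuous, the equation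
  itself does not give any higher regularity in \<open>t\<close>.
\<close>

definition smooth_in_time :: "real set \<Rightarrow> (complex \<Rightarrow> real \<Rightarrow> complex) \<Rightarrow> bool" where
  "smooth_in_time I f \<longleftrightarrow>
     (\<forall>z\<in>cball 0 1. \<forall>t\<in>I. f z differentiable (at t within I)) \<and>
     continuous_on (cball 0 1 \<times> I) (\<lambda>(z, t). time_deriv I f z t)"

definition time_interval :: "real set \<Rightarrow> bool" where
  "time_interval I \<longleftrightarrow> is_interval I \<and> (\<exists>s\<in>I. \<exists>t\<in>I. s < t)"

text \<open>
  Locally univalent solutions of the Polubarinova-Galin equation. The library's \<open>analytic_on\<close>
  says that \<open>f(\<cdot>,t)\<close> is holomorphic in a neighbourhood (possibly depending on \<open>t\<close>) of the closed disk.
\<close>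

definition locally_univalent_PG_solution ::
    "real set \<Rightarrow> (real \<Rightarrow> real) \<Rightarrow> (complex \<Rightarrow> real \<Rightarrow> complex) \<Rightarrow> bool" where
  "locally_univalent_PG_solution I q f \<longleftrightarrow>
     time_interval I \<and> continuous_on I q \<and>
     (\<forall>t\<in>I. (\<lambda>z. f z t) analytic_on cball 0 1) \<and>
     (\<forall>t\<in>I. f 0 t = 0) \<and>
     (\<forall>t\<in>I. space_deriv f 0 t \<in> \<real> \<and> Re (space_deriv f 0 t) > 0) \<and>
     (\<forall>t\<in>I. \<forall>z\<in>cball 0 1. space_deriv f z t \<noteq> 0) \<and>
     smooth_in_time I f \<and>
     (\<forall>t\<in>I. \<forall>z\<in>sphere 0 1. Re (time_deriv I f z t * cnj (z * space_deriv f z t)) = q t)"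

text \<open>
  \<open>d/dt log \<phi> = D\<close> on \<open>I\<close>, for a complex-valued \<open>\<phi>\<close>: some branch of \<open>log \<phi>\<close> along \<open>I\<close> is
  differentiable with derivative \<open>D\<close>. Two continuous branches on an interval differ by a constant,
  so the choice of the branch is immaterial.
\<close>

definition has_log_deriv :: "real set \<Rightarrow> (real \<Rightarrow> complex) \<Rightarrow> (real \<Rightarrow> complex) \<Rightarrow> bool" where
  "has_log_deriv I \<phi> D \<longleftrightarrow>
     (\<exists>L. (\<forall>t\<in>I. exp (L t) = \<phi> t) \<and> (\<forall>t\<in>I. (L has_vector_derivative D t) (at t within I)))"

definition reflect :: "complex \<Rightarrow> complex" where
  "reflect w = 1 / cnj w"

definition A_coeff :: "nat \<Rightarrow> nat \<Rightarrow> (real \<Rightarrow> real) \<Rightarrow> (real \<Rightarrow> complex) \<Rightarrow>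
    (nat \<Rightarrow> real \<Rightarrow> complex) \<Rightarrow> (nat \<Rightarrow> real \<Rightarrow> complex) \<Rightarrow> nat \<Rightarrow> real \<Rightarrow> complex" where
  "A_coeff m n q b \<omega> \<zeta> k t =
     of_real (q t) / of_real ((cmod (b t))\<^sup>2) *
     (((\<Prod>j=1..n. \<omega> k t - \<zeta> j t) * (\<Prod>j=1..n. cnj (reflect (\<omega> k t) - \<zeta> j t))) /
      ((\<Prod>j\<in>{1..m} - {k}. \<omega> k t - \<omega> j t) * (\<Prod>j=1..m. cnj (reflect (\<omega> k t) - \<omega> j t))))"

text \<open>Below, \<open>a1\<close> stands for \<open>a\<^sub>1(t) = g(0,t)\<close>.\<close>

definition A_infinity :: "nat \<Rightarrow> nat \<Rightarrow> (real \<Rightarrow> real) \<Rightarrow> (real \<Rightarrow> complex) \<Rightarrow>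
    (real \<Rightarrow> complex) \<Rightarrow> real \<Rightarrow> complex" where
  "A_infinity m n q b a1 t = (if m = n then of_real (q t) / (b t * a1 t) else 0)"

definition A_zero :: "nat \<Rightarrow> nat \<Rightarrow> (real \<Rightarrow> real) \<Rightarrow> (real \<Rightarrow> complex) \<Rightarrow> (real \<Rightarrow> complex) \<Rightarrow>
    (nat \<Rightarrow> real \<Rightarrow> complex) \<Rightarrow> (nat \<Rightarrow> real \<Rightarrow> complex) \<Rightarrow> real \<Rightarrow> complex" where
  "A_zero m n q b a1 \<omega> \<zeta> t =
     A_infinity m n q b a1 t + (\<Sum>j=1..m. A_coeff m n q b \<omega> \<zeta> j t / \<omega> j t)"

end

theory Submission
  imports Defs "HOL-Complex_Analysis.Complex_Analysis"
begin

text \<open>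
  On the unit circle the Polubarinova-Galin equation reads \<open>Re p = q / |g|\<^sup>2\<close> for
  \<open>p = (\<partial>f/\<partial>t) / (z g)\<close>, where \<open>p\<close> is holomorphic in the disk and real at \<open>0\<close>. Partial fractions of
  \<open>q / (g g\<^sup>*)\<close> exhibit the rational function \<open>A0 + (\<Sum>k. 2 * A k / (z - \<omega> k))\<close> with the same properties,
  so it equals \<open>p\<close>. Differentiating \<open>\<partial>f/\<partial>t = z g p\<close> in \<open>z\<close> gives the logarithmic time derivative of \<open>g\<close>
  as a rational function, and its poles and residues are the asserted velocities.

  Differentiability of the zeros and poles in time is not assumed. For \<open>b\<close> and the simple zeros it
  follows because a polynomial of bounded degree is determined linearly by its values in the disk.
  Poles may a priori collide and split; there the equation for the denominator, valid at all times,
  bounds how far the poles of a cluster can deviate from the common velocity.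
\<close>

section \<open>Polynomials with moving roots\<close>

text \<open>The factor 2 and the shift from \<open>A_infinity\<close> to \<open>A0\<close> come from
  the circle. There q / |g|^2 equals \<open>c + T + cnj T + cnj S\<close>, where
  \<open>T = (\<Sum>k. A k / (z - \<omega> k))\<close>,
  \<open>S = (\<Sum>k. A k / \<omega> k)\<close> and \<open>c\<close> is the value at infinity,
  because the pole parts inside the disk mirror those outside. Its real part is that of
  \<open>(c + S) + 2 * T\<close>, which has no pole in the closed disk, and \<open>c + S\<close> is
  \<open>A0\<close>. Time derivatives are known only in the disk, while zeros and poles lie outside;
  Lagrange interpolation carries the information across. At a pole of order c, differentiability of
  the denominator at a single time bounds the deviation of the poles after time h only by
  o(h^(1/c)), which is too weak. What helps is that the velocity field depends on a pole only
  through its position and is continuous: in a frame moving with the common velocity, the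
  denominator changes at a rate that is itself small near the cluster.\<close>

definition root_poly :: "'i set \<Rightarrow> ('i \<Rightarrow> complex) \<Rightarrow> complex poly" where
  "root_poly J r = (\<Prod>j\<in>J. [:- r j, 1:])"

text \<open>The time derivative of \<open>root_poly J r\<close> if the roots \<open>r j\<close> move with velocities \<open>v j\<close>.\<close>

definition root_poly_var :: "'i set \<Rightarrow> ('i \<Rightarrow> complex) \<Rightarrow> ('i \<Rightarrow> complex) \<Rightarrow> complex poly" where
  "root_poly_var J r v = - (\<Sum>j\<in>J. smult (v j) (root_poly (J - {j}) r))"

lemma poly_root_poly [simp]: "poly (root_poly J r) z = (\<Prod>j\<in>J. z - r j)"
  by (simp add: root_poly_def poly_prod algebra_simps)

lemma monic_root_poly: "lead_coeff (root_poly J r) = 1"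
  by (simp add: root_poly_def lead_coeff_prod)

lemma degree_root_poly [simp]: "degree (root_poly J r) = card J"
  by (cases "finite J") (simp_all add: root_poly_def degree_prod_eq_sum_degree)

lemma coeff_root_poly_card [simp]: "coeff (root_poly J r) (card J) = 1"
  using monic_root_poly[of J r] by simp

lemma poly_root_poly_var:
  "poly (root_poly_var J r v) z = - (\<Sum>j\<in>J. v j * (\<Prod>i\<in>J - {j}. z - r i))"
  by (simp add: root_poly_var_def poly_sum)

lemma degree_root_poly_var: "degree (root_poly_var J r v) \<le> card J"
proof (cases "finite J")
  case True
  have "degree (smult (v j) (root_poly (J - {j}) r)) \<le> card J" for j
    by (rule order_trans[OF degree_smult_le]) (simp add: True card_mono)
  then show ?thesis
    unfolding root_poly_var_def by (simp add: degree_sum_le True)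
qed (simp add: root_poly_var_def)

text \<open>Moving the roots keeps the polynomial monic, so its time derivative loses the top
  coefficient. This lets the top coefficient in \<open>rational_motion\<close> see only the motion
  of \<open>b\<close>.\<close>

lemma coeff_root_poly_var_card [simp]: "coeff (root_poly_var J r v) (card J) = 0"
proof (cases "finite J")
  case True
  have "coeff (root_poly (J - {j}) r) (card J) = 0" if "j \<in> J" for j
    by (rule coeff_eq_0) (use that True in \<open>simp only: degree_root_poly card_Diff1_less\<close>)
  then show ?thesis
    by (simp add: root_poly_var_def coeff_sum)
qed (simp add: root_poly_var_def)

text \<open>Moving all roots with velocity 1 translates the polynomial, and the time derivative of
  p(z - s) is -p'(z - s).\<close>

lemma pderiv_root_poly: "pderiv (root_poly J r) = - root_poly_var J r (\<lambda>_. 1)"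
  by (simp add: root_poly_def root_poly_var_def pderiv_prod pderiv_pCons)

lemma lagrange_interpolation:
  fixes X :: "complex set"
  assumes "finite X" "degree p < card X"
  shows "p = (\<Sum>x\<in>X. smult (poly p x / (\<Prod>y\<in>X - {x}. x - y)) (root_poly (X - {x}) id))" (is "p = ?L")
proof (rule poly_eqI_degree)
  show "poly p x = poly ?L x" if "x \<in> X" for x
  proof -
    have "poly ?L x = (\<Sum>y\<in>X. if y = x then poly p x else 0)"
      unfolding poly_sum
    proof (rule sum.cong)
      show "poly (smult (poly p y / (\<Prod>z\<in>X - {y}. y - z)) (root_poly (X - {y}) id)) x =
            (if y = x then poly p x else 0)" if "y \<in> X" for y
        using assms that \<open>x \<in> X\<close> by (auto simp: prod_zero_iff)
    qed simp
    then show ?thesis using assms that by simp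
  qed
  have "degree ?L \<le> card X - 1"
    by (rule degree_sum_le) (use assms in \<open>auto intro!: order_trans[OF degree_smult_le]\<close>)
  then show "degree ?L < card X" using assms by simp
qed (fact assms(2))

text \<open>Subtracting the top coefficient times \<open>root_poly X id\<close> brings the degree
  below \<open>card X\<close> and keeps the values on \<open>X\<close>. Dividing the Lagrange
  formula for the rest by the full product gives the pole parts.\<close>

lemma partial_fractions:
  fixes X :: "complex set"
  assumes "finite X" "degree p \<le> card X" "z \<notin> X"
  shows "poly p z / (\<Prod>x\<in>X. z - x) =
    coeff p (card X) + (\<Sum>x\<in>X. poly p x / (\<Prod>y\<in>X - {x}. x - y) / (z - x))"
\<comment> \<open>No polynomial has degree below 0, so the reduction to
  \<open>lagrange_interpolation\<close> needs a nonempty \<open>X\<close>.\<close>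
proof (cases "X = {}")
  case True
  with assms show ?thesis by (auto elim!: degree_eq_zeroE)
next
  case False
  define c where "c = coeff p (card X)"
  define s where "s = p - smult c (root_poly X id)"
  have "degree s < card X"
  proof -
    have "degree s \<le> card X"
      unfolding s_def by (intro degree_diff_le assms order_trans[OF degree_smult_le]) simp
    moreover have "coeff s (card X) = 0" by (simp add: s_def c_def)
    moreover have "card X > 0" using False assms by (simp add: card_gt_0_iff)
    ultimately show ?thesis
      by (metis coeff_eq_0 le_neq_implies_less leading_coeff_0_iff degree_0)
  qed
  from arg_cong[OF lagrange_interpolation[OF assms(1) this], of "\<lambda>p. poly p z"]
  have s: "poly s z = (\<Sum>x\<in>X. poly s x / (\<Prod>y\<in>X - {x}. x - y) * (\<Prod>y\<in>X - {x}. z - y))"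
    by (simp add: poly_sum)
  have nz: "(\<Prod>x\<in>X. z - x) \<noteq> 0" using assms by auto
  have "poly p z / (\<Prod>x\<in>X. z - x) = c + poly s z / (\<Prod>x\<in>X. z - x)"
    using nz by (simp add: s_def field_simps)
  also have "poly s z / (\<Prod>x\<in>X. z - x) = (\<Sum>x\<in>X. poly p x / (\<Prod>y\<in>X - {x}. x - y) / (z - x))"
    unfolding s sum_divide_distrib
  proof (rule sum.cong)
    fix x assume x: "x \<in> X"
    have "poly s x = poly p x" using x assms by (auto simp: s_def)
    moreover have "(\<Prod>y\<in>X. z - y) = (z - x) * (\<Prod>y\<in>X - {x}. z - y)"
      using assms x by (simp add: prod.remove)
    ultimately show "poly s x / (\<Prod>y\<in>X - {x}. x - y) * (\<Prod>y\<in>X - {x}. z - y) / (\<Prod>x\<in>X. z - x) =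
        poly p x / (\<Prod>y\<in>X - {x}. x - y) / (z - x)"
      using nz by simp
  qed simp
  finally show ?thesis by (simp add: c_def)
qed

text \<open>Lagrange interpolation at N + 1 nodes. Nodes and weights serve all polynomials of degree
  at most \<open>N\<close> at once, so they do not change when the polynomial moves in time.\<close>

lemma coeff_from_values:
  fixes X :: "complex set"
  assumes "infinite X"
  obtains Y c where "finite Y" "Y \<subseteq> X"
    "\<And>p. degree p \<le> N \<Longrightarrow> coeff p k = (\<Sum>y\<in>Y. c y * poly p y)"
proof -
  obtain Y where Y: "finite Y" "Y \<subseteq> X" "card Y = Suc N"
    using infinite_arbitrarily_large[OF assms] by metis
  show ?thesis
  proof (rule that[OF Y(1,2)])
    fix p :: "complex poly" assume "degree p \<le> N"
    then have "degree p < card Y" using Y by simp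
    from arg_cong[OF lagrange_interpolation[OF Y(1) this], of "\<lambda>p. coeff p k"]
    show "coeff p k = (\<Sum>y\<in>Y. (coeff (root_poly (Y - {y}) id) k / (\<Prod>x\<in>Y - {y}. y - x)) * poly p y)"
      by (simp add: coeff_sum mult_ac)
  qed
qed

text \<open>The coefficient is a fixed finite linear combination of values on \<open>X\<close>. With
  \<open>X\<close> the unit disk, differentiability there passes to the coefficients, hence to
  values at the zeros outside.\<close>

lemma coeff_has_vector_derivative:
  fixes p :: "real \<Rightarrow> complex poly"
  assumes "infinite X" and "t \<in> I" and deg: "\<And>s. s \<in> I \<Longrightarrow> degree (p s) \<le> N" "degree p' \<le> N"
    and der: "\<And>x. x \<in> X \<Longrightarrow> ((\<lambda>s. poly (p s) x) has_vector_derivative poly p' x) (at t within I)"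
  shows "((\<lambda>s. coeff (p s) k) has_vector_derivative coeff p' k) (at t within I)"
proof -
  obtain Y c where Y: "finite Y" "Y \<subseteq> X"
    "\<And>p. degree p \<le> N \<Longrightarrow> coeff p k = (\<Sum>y\<in>Y. c y * poly p y)"
    using coeff_from_values[OF assms(1)] by metis
  have "((\<lambda>s. \<Sum>y\<in>Y. c y * poly (p s) y) has_vector_derivative (\<Sum>y\<in>Y. c y * poly p' y)) (at t within I)"
    using Y(2) by (intro has_vector_derivative_sum has_vector_derivative_mult_right der) auto
  then have "((\<lambda>s. \<Sum>y\<in>Y. c y * poly (p s) y) has_vector_derivative coeff p' k) (at t within I)"
    using Y(3) deg by simp
  then show ?thesis
    by (rule has_vector_derivative_transform[OF \<open>t \<in> I\<close>, rotated]) (use Y(3) deg in simp)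
qed

section \<open>Product and chain rules for moving polynomials\<close>

lemma has_vector_derivative_iff_tendsto:
  "(h has_vector_derivative h') (at t within I) \<longleftrightarrow>
     ((\<lambda>s. (h s - h t) /\<^sub>R (s - t)) \<longlongrightarrow> h') (at t within I)"
proof -
  have "norm (h s - h t - (s - t) *\<^sub>R h') / norm (s - t) = norm ((h s - h t) /\<^sub>R (s - t) - h')"
    if "s \<noteq> t" for s
  proof -
    have "(h s - h t) /\<^sub>R (s - t) - h' = (h s - h t - (s - t) *\<^sub>R h') /\<^sub>R (s - t)"
      using that by (simp add: scaleR_diff_right)
    then show ?thesis by (simp add: divide_inverse mult.commute)
  qed
  then have ev: "\<forall>\<^sub>F s in at t within I. norm (h s - h t - (s - t) *\<^sub>R h') / norm (s - t) =
      norm ((h s - h t) /\<^sub>R (s - t) - h')"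
    by (auto simp: eventually_at_filter)
  have "bounded_linear (\<lambda>x. x *\<^sub>R h')" by (rule bounded_linear_scaleR_left)
  then show ?thesis
    using filterlim_cong[OF refl refl ev, of "nhds 0"]
    by (simp add: has_vector_derivative_def has_derivative_iff_norm tendsto_norm_zero_iff
        LIM_zero_iff)
qed

text \<open>As \<open>h\<close> vanishes at \<open>t\<close>, the difference quotient of the product
  is that of \<open>h\<close> times \<open>k s\<close>, so continuity of \<open>k\<close> suffices.
  This handles factors built from zeros and poles that are so far only known to be
  continuous.\<close>

lemma has_vector_derivative_mult_vanishing:
  fixes h k :: "real \<Rightarrow> complex"
  assumes "(h has_vector_derivative h') (at t within I)" "h t = 0" "continuous (at t within I) k"
  shows "((\<lambda>s. h s * k s) has_vector_derivative h' * k t) (at t within I)"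
proof -
  have "((\<lambda>s. (h s - h t) /\<^sub>R (s - t) * k s) \<longlongrightarrow> h' * k t) (at t within I)"
    using assms(1,3) by (intro tendsto_mult) (simp_all add: has_vector_derivative_iff_tendsto continuous_within)
  then show ?thesis
    using assms(2) by (simp add: has_vector_derivative_iff_tendsto)
qed

lemma poly_eq_sum_le:
  fixes x :: complex
  assumes "degree p \<le> n"
  shows "poly p x = (\<Sum>i\<le>n. coeff p i * x ^ i)"
  using arg_cong[OF poly_as_sum_of_monoms'[OF assms], of "\<lambda>p. poly p x"]
  by (simp add: poly_sum poly_monom)

text \<open>Write the value as (p(s) - p(t))(z(s)) + p(t)(z(s)). In the first part all coefficients
  vanish at \<open>t\<close>, so the powers of \<open>z s\<close> act as continuous factors; the
  second part is the ordinary chain rule.\<close>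

lemma poly_moving_has_vector_derivative:
  fixes p :: "real \<Rightarrow> complex poly" and z :: "real \<Rightarrow> complex"
  assumes "infinite X" and "t \<in> I" and deg: "\<And>s. s \<in> I \<Longrightarrow> degree (p s) \<le> N" "degree p' \<le> N"
    and der: "\<And>x. x \<in> X \<Longrightarrow> ((\<lambda>s. poly (p s) x) has_vector_derivative poly p' x) (at t within I)"
    and z: "(z has_vector_derivative z') (at t within I)"
  shows "((\<lambda>s. poly (p s) (z s)) has_vector_derivative poly p' (z t) + poly (pderiv (p t)) (z t) * z')
    (at t within I)"
proof -
  note co = coeff_has_vector_derivative[OF assms(1-5)]
  have cz: "continuous (at t within I) z"
    using z by (rule has_vector_derivative_continuous)
  have "((\<lambda>s. \<Sum>i\<le>N. (coeff (p s) i - coeff (p t) i) * z s ^ i) has_vector_derivative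
      (\<Sum>i\<le>N. (coeff p' i - 0) * z t ^ i)) (at t within I)"
    by (intro has_vector_derivative_sum has_vector_derivative_mult_vanishing
        has_vector_derivative_diff co has_vector_derivative_const continuous_intros cz) auto
  then have 1: "((\<lambda>s. \<Sum>i\<le>N. (coeff (p s) i - coeff (p t) i) * z s ^ i) has_vector_derivative
      poly p' (z t)) (at t within I)"
    by (simp add: poly_eq_sum_le[OF deg(2)])
  have 2: "((\<lambda>s. poly (p t) (z s)) has_vector_derivative (z' * poly (pderiv (p t)) (z t))) (at t within I)"
    using field_vector_diff_chain_within[OF z DERIV_subset[OF poly_DERIV]] by (simp add: o_def)
  have "((\<lambda>s. (\<Sum>i\<le>N. (coeff (p s) i - coeff (p t) i) * z s ^ i) + poly (p t) (z s))
     has_vector_derivative poly p' (z t) + z' * poly (pderiv (p t)) (z t)) (at t within I)"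
    by (intro has_vector_derivative_add 1 2)
  then have "((\<lambda>s. poly (p s) (z s)) has_vector_derivative poly p' (z t) + z' * poly (pderiv (p t)) (z t))
     (at t within I)"
    by (rule has_vector_derivative_transform[OF \<open>t \<in> I\<close>, rotated])
       (simp add: poly_eq_sum_le[OF deg(1)] poly_eq_sum_le[OF deg(1)[OF \<open>t \<in> I\<close>]] left_diff_distrib sum_subtractf)
  then show ?thesis by (simp add: mult.commute)
qed

section \<open>Roots of a moving polynomial near a multiple root\<close>

lemma vector_derivative_bound:
  fixes f :: "real \<Rightarrow> 'a::real_normed_vector"
  assumes "convex S" "\<And>x. x \<in> S \<Longrightarrow> (f has_vector_derivative f' x) (at x within S)"
    and "\<And>x. x \<in> S \<Longrightarrow> norm (f' x) \<le> B" "x \<in> S" "y \<in> S"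
  shows "norm (f x - f y) \<le> B * \<bar>x - y\<bar>"
proof -
  have "norm (f x - f y) \<le> B * norm (x - y)"
  proof (rule differentiable_bound[OF assms(1) _ _ assms(4,5)])
    fix s assume "s \<in> S"
    then show "(f has_derivative (\<lambda>h. h *\<^sub>R f' s)) (at s within S)"
      using assms(2) by (simp add: has_vector_derivative_def)
    show "onorm (\<lambda>h. h *\<^sub>R f' s) \<le> B"
      by (rule order_trans[OF onorm_bound[of "norm (f' s)"] assms(3)]) (use \<open>s \<in> S\<close> in \<open>simp_all add: mult.commute\<close>)
  qed
  then show ?thesis by simp
qed

lemma finite_family_close_within:
  fixes g :: "'i \<Rightarrow> real \<Rightarrow> complex"
  assumes "finite J" "\<And>i. i \<in> J \<Longrightarrow> continuous_on I (g i)" "t0 \<in> I" "e > 0"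
  obtains d where "d > 0" "\<And>i t. i \<in> J \<Longrightarrow> t \<in> I \<Longrightarrow> \<bar>t - t0\<bar> < d \<Longrightarrow> cmod (g i t - g i t0) < e"
proof -
  have "\<exists>d>0. \<forall>i\<in>J. \<forall>t\<in>I. \<bar>t - t0\<bar> < d \<longrightarrow> cmod (g i t - g i t0) < e"
    using assms(1,2)
  proof (induction J rule: finite_induct)
    case empty
    show ?case by (auto intro: exI[of _ 1])
  next
    case (insert j J)
    then obtain d where d: "d > 0" "\<forall>i\<in>J. \<forall>t\<in>I. \<bar>t - t0\<bar> < d \<longrightarrow> cmod (g i t - g i t0) < e"
      by auto
    have "continuous_on I (g j)" using insert.prems by simp
    then obtain d' where d': "d' > 0" "\<forall>t\<in>I. \<bar>t - t0\<bar> < d' \<longrightarrow> cmod (g j t - g j t0) < e"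
      using assms(3,4) unfolding continuous_on_iff dist_norm real_norm_def by metis
    show ?case
      using d d' by (intro exI[of _ "min d d'"]) auto
  qed
  then show ?thesis using that by metis
qed

text \<open>
  A quantitative first-exit estimate: the roots \<open>r i\<close> that start at \<open>r0\<close> are followed in the frame
  moving with velocity \<open>v0\<close>. If one of them were the first to leave the disk of radius \<open>\<rho>\<close>, at the
  displacement \<open>u\<close>, then the polynomial evaluated at the moving point with constant displacement \<open>u\<close>
  would have to change from about \<open>\<rho> ^ c\<close> to \<open>0\<close>, \<open>c\<close> being the number of these roots; its
  derivative is too small for that.
\<close>

lemma roots_stay_close:
  fixes r v :: "'i \<Rightarrow> real \<Rightarrow> complex" and r0 v0 :: complex and t0 t1 \<rho> \<delta> V M \<kappa> :: real
  defines "w \<equiv> \<lambda>i t. r i t - r0 - (t - t0) *\<^sub>R v0"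
  assumes seg: "closed_segment t0 t1 \<subseteq> I" and J: "finite C" "finite U" "C \<inter> U = {}" "C \<noteq> {}"
    and contr: "\<And>i. i \<in> C \<Longrightarrow> continuous_on I (r i)"
    and X: "infinite X"
    and der: "\<And>s z. s \<in> I \<Longrightarrow> z \<in> X \<Longrightarrow> ((\<lambda>t. \<Prod>i\<in>C \<union> U. z - r i t) has_vector_derivative
        poly (root_poly_var (C \<union> U) (\<lambda>i. r i s) (\<lambda>i. v i s)) z) (at s within I)"
    and C: "\<And>i. i \<in> C \<Longrightarrow> r i t0 = r0"
    and \<rho>: "\<rho> > 0"
    and vC: "\<And>i t. i \<in> C \<Longrightarrow> t \<in> closed_segment t0 t1 \<Longrightarrow> cmod (v i t - v0) \<le> \<delta>"
    and vO: "\<And>i t. i \<in> U \<Longrightarrow> t \<in> closed_segment t0 t1 \<Longrightarrow> cmod (v i t - v0) \<le> V" and "V \<ge> 0"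
    and rO: "\<And>i t u. i \<in> U \<Longrightarrow> t \<in> closed_segment t0 t1 \<Longrightarrow> cmod u \<le> \<rho> \<Longrightarrow>
       cmod (r0 + (t - t0) *\<^sub>R v0 + u - r i t) \<le> M" and M: "M \<ge> 1"
    and \<kappa>: "\<And>u. cmod u \<le> \<rho> \<Longrightarrow> cmod (\<Prod>i\<in>U. r0 + u - r i t0) > \<kappa>"
    and small: "\<bar>t1 - t0\<bar> * (card (C \<union> U) * (M ^ card U * (\<delta> * (2 * \<rho>) ^ (card C - 1) + V * (2 * \<rho>) ^ card C)))
        \<le> \<kappa> * \<rho> ^ card C"
    and i: "i \<in> C"
  shows "cmod (w i t1) < \<rho>"
proof (rule ccontr)
  assume out: "\<not> cmod (w i t1) < \<rho>"
  \<comment> \<open>Parametrising from \<open>t0\<close> covers \<open>t1 < t0\<close> as well;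
    "first exit" means first when going away from \<open>t0\<close>.\<close>
  define \<gamma> where "\<gamma> s = t0 + s * (t1 - t0)" for s :: real
  have \<gamma>seg: "\<gamma> s \<in> closed_segment t0 t1" if "0 \<le> s" "s \<le> 1" for s
    using that unfolding \<gamma>_def in_segment by (intro exI[of _ s]) (simp add: algebra_simps)
  have \<gamma>I: "\<gamma> s \<in> I" if "0 \<le> s" "s \<le> 1" for s
    using \<gamma>seg[OF that] seg by blast
  have \<gamma>01 [simp]: "\<gamma> 0 = t0" "\<gamma> 1 = t1" by (simp_all add: \<gamma>_def)
  have cont: "continuous_on {0..1} (\<lambda>s. cmod (w k (\<gamma> s)))" if "k \<in> C" for k
    unfolding w_def
    by (intro continuous_intros continuous_on_compose2[OF contr[OF that], of _ \<gamma>])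
       (auto simp: \<gamma>I, auto simp: \<gamma>_def intro!: continuous_intros)
  have w0 [simp]: "w k t0 = 0" if "k \<in> C" for k
    using C[OF that] by (simp add: w_def)
  define S where "S = (\<Union>k\<in>C. {s\<in>{0..1}. \<rho> \<le> cmod (w k (\<gamma> s))})"
  have "closed S"
    unfolding S_def using J(1) by (intro closed_UN ballI continuous_on_closed_Collect_le cont continuous_intros) auto
  moreover have "bounded S"
    by (rule bounded_subset[of "{0..1}"]) (auto simp: S_def)
  moreover have "1 \<in> S" using out i by (force simp: S_def)
  ultimately obtain s1 where s1: "s1 \<in> S" "\<And>s. s \<in> S \<Longrightarrow> s1 \<le> s"
    using compact_attains_inf[of S] by (auto simp: compact_eq_bounded_closed)
  then obtain k where k: "k \<in> C" "0 \<le> s1" "s1 \<le> 1" "\<rho> \<le> cmod (w k (\<gamma> s1))"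
    by (auto simp: S_def)
  \<comment> \<open>A displacement above \<rho> at \<open>s\<close> would force the value \<rho> at
    some \<open>x \<le> s\<close>. Then \<open>x\<close> lies in \<open>S\<close>, and minimality of
    \<open>s1\<close> leaves only \<open>x = s\<close>. The case \<open>s = s1\<close> is included,
    so the exit displacement \<open>u\<close> has modulus exactly \<rho>.\<close>
  have inside: "cmod (w l (\<gamma> s)) \<le> \<rho>" if "l \<in> C" "0 \<le> s" "s \<le> s1" for l s
  proof (rule ccontr)
    note lC = that
    assume n: "\<not> cmod (w l (\<gamma> s)) \<le> \<rho>"
    have "continuous_on {0..s} (\<lambda>s. cmod (w l (\<gamma> s)))"
      using that k by (intro continuous_on_subset[OF cont]) auto
    then obtain x where x: "0 \<le> x" "x \<le> s" "cmod (w l (\<gamma> x)) = \<rho>"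
      using IVT'[of "\<lambda>s. cmod (w l (\<gamma> s))" 0 \<rho> s] lC n \<rho> w0[OF lC(1)] by auto
    have "x \<in> S" using x that k by (auto simp: S_def)
    then have "x = s" using s1(2)[of x] x lC by simp
    then show False using x n by simp
  qed
  define u where "u = w k (\<gamma> s1)"
  have u: "cmod u = \<rho>" using inside[of k s1] k by (auto simp: u_def)
  define T where "T = \<gamma> s1"
  define Sg where "Sg = closed_segment t0 T"
  have Tseg: "T \<in> closed_segment t0 t1" using \<gamma>seg k by (simp add: T_def)
  then have Sgseg: "Sg \<subseteq> closed_segment t0 t1"
    unfolding Sg_def by (intro closed_segment_subset) auto
  have inside': "cmod (w l t) \<le> \<rho>" if "l \<in> C" "t \<in> Sg" for l t
  proof -
    from that obtain x where x: "0 \<le> x" "x \<le> 1" "t = (1 - x) * t0 + x * T"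
      by (auto simp: Sg_def in_segment)
    have "t = \<gamma> (x * s1)" by (simp add: x(3) T_def \<gamma>_def algebra_simps)
    moreover have "x * s1 \<le> s1" using x k by (simp add: mult_left_le_one_le)
    ultimately show ?thesis using inside[of l "x * s1"] that x k by simp
  qed
  define p where "p t = root_poly (C \<union> U) (\<lambda>i. r i t)" for t
  \<comment> \<open>At time \<open>T\<close> this point is the root \<open>r k T\<close>; at
    \<open>t0\<close> it is \<open>r0 + u\<close>, at distance \<rho> from the whole
    cluster.\<close>
  define z where "z t = r0 + (t - t0) *\<^sub>R v0 + u" for t
  define \<phi>' where "\<phi>' t = poly (root_poly_var (C \<union> U) (\<lambda>i. r i t) (\<lambda>i. v i t)) (z t) + poly (pderiv (p t)) (z t) * v0" for t
  \<comment> \<open>Bounds one summand of the derivative. For a root in \<open>C\<close> the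
    relative velocity is at most \<delta> and \<open>card C - 1\<close> factors of size at most
    \<open>2 * \<rho>\<close> remain; for a root in \<open>U\<close> the relative velocity is only
    at most \<open>V\<close>, but all \<open>card C\<close> small factors remain.\<close>
  define B where "B = M ^ card U * (\<delta> * (2 * \<rho>) ^ (card C - 1) + V * (2 * \<rho>) ^ card C)"
  have \<phi>': "((\<lambda>t. poly (p t) (z t)) has_vector_derivative \<phi>' t) (at t within Sg)" if "t \<in> Sg" for t
  proof -
    have tI: "t \<in> I" using that Sgseg seg by blast
    have "((\<lambda>t. poly (p t) (z t)) has_vector_derivative \<phi>' t) (at t within I)"
      unfolding \<phi>'_def
    proof (rule poly_moving_has_vector_derivative[OF X tI])
      show "degree (p s) \<le> card (C \<union> U)" for s by (simp add: p_def)
      show "(z has_vector_derivative v0) (at t within I)"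
        unfolding z_def by (auto intro!: derivative_eq_intros simp: has_vector_derivative_def)
    qed (use der tI in \<open>simp_all add: p_def degree_root_poly_var\<close>)
    then show ?thesis
      by (rule has_vector_derivative_within_subset) (use Sgseg seg in blast)
  qed
  have zw: "z t - r l t = u - w l t" for t l by (simp add: z_def w_def)
  have pC: "cmod (\<Prod>l\<in>C'. z t - r l t) \<le> (2 * \<rho>) ^ card C'" if "t \<in> Sg" "C' \<subseteq> C" for t C'
  proof -
    have "cmod (z t - r l t) \<le> 2 * \<rho>" if "l \<in> C'" for l
      unfolding zw using norm_triangle_ineq4[of u "w l t"] inside'[of l t] \<open>t \<in> Sg\<close> u that \<open>C' \<subseteq> C\<close> by auto
    then show ?thesis
      unfolding prod_norm[symmetric] using prod_mono[of C' "\<lambda>l. cmod (z t - r l t)" "\<lambda>_. 2 * \<rho>"] by simp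
  qed
  have pO: "cmod (\<Prod>l\<in>U'. z t - r l t) \<le> M ^ card U" if "t \<in> Sg" "U' \<subseteq> U" for t U'
  proof -
    have "cmod (z t - r l t) \<le> M" if "l \<in> U'" for l
      unfolding z_def using rO[of l t u] \<open>t \<in> Sg\<close> u that \<open>U' \<subseteq> U\<close> Sgseg by auto
    then have "cmod (\<Prod>l\<in>U'. z t - r l t) \<le> M ^ card U'"
      unfolding prod_norm[symmetric] using prod_mono[of U' "\<lambda>l. cmod (z t - r l t)" "\<lambda>_. M"] by simp
    also have "\<dots> \<le> M ^ card U"
      using M that J by (intro power_increasing card_mono) auto
    finally show ?thesis .
  qed
  have \<delta>0: "\<delta> \<ge> 0" using vC[OF k(1), of t0] norm_ge_zero[of "v k t0 - v0"] ends_in_segment by (meson order_trans)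
  have bound: "cmod (\<phi>' t) \<le> card (C \<union> U) * B" if t: "t \<in> Sg" for t
  proof -
    have tseg: "t \<in> closed_segment t0 t1" using t Sgseg by auto
    \<comment> \<open>The space derivative is, up to sign, the variation with all velocities 1, so
      the motion of the test point leaves only the relative velocities
      \<open>v0 - v i t\<close>.\<close>
    have "\<phi>' t = (\<Sum>i\<in>C \<union> U. (v0 - v i t) * (\<Prod>l\<in>(C \<union> U) - {i}. z t - r l t))"
      by (simp add: \<phi>'_def p_def pderiv_root_poly poly_root_poly_var left_diff_distrib
          sum_subtractf sum_distrib_left[symmetric] mult.commute[of _ v0])
    also have "cmod \<dots> \<le> (\<Sum>i\<in>C \<union> U. B)"
    proof (rule order_trans[OF norm_sum sum_mono])
      fix i assume i: "i \<in> C \<union> U"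
      show "cmod ((v0 - v i t) * (\<Prod>l\<in>(C \<union> U) - {i}. z t - r l t)) \<le> B"
      proof (cases "i \<in> C")
        case True
        have "(\<Prod>l\<in>(C \<union> U) - {i}. z t - r l t) = (\<Prod>l\<in>C - {i}. z t - r l t) * (\<Prod>l\<in>U. z t - r l t)"
          using True J by (subst prod.union_disjoint[symmetric]) (auto intro!: prod.cong)
        then have "cmod ((v0 - v i t) * (\<Prod>l\<in>(C \<union> U) - {i}. z t - r l t)) \<le>
            \<delta> * ((2 * \<rho>) ^ card (C - {i}) * M ^ card U)"
          using vC[OF True tseg] pC[OF t, of "C - {i}"] pO[OF t, of U] \<rho> \<delta>0
          by (simp only: norm_mult norm_minus_commute[of v0]) (intro mult_mono, auto)
        also have "\<dots> = M ^ card U * (\<delta> * (2 * \<rho>) ^ (card C - 1) + 0)"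
          using True J by simp
        also have "\<dots> \<le> B"
          unfolding B_def using M \<rho> \<open>V \<ge> 0\<close> by (intro mult_left_mono add_left_mono) auto
        finally show ?thesis .
      next
        case False
        with i have iO: "i \<in> U" by simp
        have "(\<Prod>l\<in>(C \<union> U) - {i}. z t - r l t) = (\<Prod>l\<in>C. z t - r l t) * (\<Prod>l\<in>U - {i}. z t - r l t)"
          using False J by (subst prod.union_disjoint[symmetric]) (auto intro!: prod.cong)
        then have "cmod ((v0 - v i t) * (\<Prod>l\<in>(C \<union> U) - {i}. z t - r l t)) \<le>
            V * ((2 * \<rho>) ^ card C * M ^ card U)"
          using vO[OF iO tseg] pC[OF t, of C] pO[OF t, of "U - {i}"] \<rho> \<open>V \<ge> 0\<close>
          by (simp only: norm_mult norm_minus_commute[of v0]) (intro mult_mono, auto)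
        also have "\<dots> = M ^ card U * (0 + V * (2 * \<rho>) ^ card C)" by simp
        also have "\<dots> \<le> B"
          unfolding B_def using M \<rho> \<delta>0 by (intro mult_left_mono add_right_mono) auto
        finally show ?thesis .
      qed
    qed
    finally show ?thesis by simp
  qed
  have B0: "B \<ge> 0" unfolding B_def using M \<rho> \<open>V \<ge> 0\<close> \<delta>0 by auto
  have "cmod (poly (p T) (z T) - poly (p t0) (z t0)) \<le> card (C \<union> U) * B * \<bar>T - t0\<bar>"
    by (rule vector_derivative_bound[where S = Sg, OF _ \<phi>' bound]) (auto simp: Sg_def)
  also have "\<dots> \<le> card (C \<union> U) * B * \<bar>t1 - t0\<bar>"
    using B0 Tseg segment_bound1[OF Tseg] by (intro mult_left_mono) auto
  also have "\<dots> \<le> \<kappa> * \<rho> ^ card C"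
    using small by (simp add: B_def mult_ac)
  finally have "cmod (poly (p T) (z T) - poly (p t0) (z t0)) \<le> \<kappa> * \<rho> ^ card C" .
  moreover have "poly (p T) (z T) = 0"
    using k J by (auto simp: p_def prod_zero_iff zw u_def T_def)
  moreover have "poly (p t0) (z t0) = u ^ card C * (\<Prod>i\<in>U. r0 + u - r i t0)"
  proof -
    have "poly (p t0) (z t0) = (\<Prod>i\<in>C. z t0 - r i t0) * (\<Prod>i\<in>U. z t0 - r i t0)"
      unfolding p_def poly_root_poly using J by (intro prod.union_disjoint) auto
    also have "(\<Prod>i\<in>C. z t0 - r i t0) = u ^ card C"
      using C by (simp add: z_def)
    finally show ?thesis by (simp add: z_def)
  qed
  ultimately have "cmod (\<Prod>i\<in>U. r0 + u - r i t0) * \<rho> ^ card C \<le> \<kappa> * \<rho> ^ card C"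
    by (simp add: norm_mult norm_power u mult.commute)
  then have "cmod (\<Prod>i\<in>U. r0 + u - r i t0) \<le> \<kappa>"
    using \<rho> by simp
  then show False using \<kappa>[of u] u by simp
qed

text \<open>\<open>roots_stay_close\<close> is applied with \<rho> = \<epsilon> \<tau>, where \<tau>
  is the elapsed time. Up to constants the polynomial can then change by \<tau> (\<delta>
  \<rho>^(c-1) + \<rho>^c) = (\<delta>/\<epsilon> + \<tau>) \<rho>^c, against a value of order
  \<rho>^c at the start; small \<delta> and \<tau> rule out an exit. Assumption \<open>eq\<close>
  provides the common velocity of the roots that coincide at \<open>t0\<close>, and continuity of
  \<open>v\<close> keeps their velocities \<delta>-close to it.\<close>

lemma roots_has_vector_derivative:
  fixes r v :: "'i \<Rightarrow> real \<Rightarrow> complex"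
  assumes I: "is_interval I" "t0 \<in> I" and J: "finite J" "j \<in> J"
    and contr: "\<And>i. i \<in> J \<Longrightarrow> continuous_on I (r i)"
    and contv: "\<And>i. i \<in> J \<Longrightarrow> continuous_on I (v i)"
    and X: "infinite X"
    and der: "\<And>s z. s \<in> I \<Longrightarrow> z \<in> X \<Longrightarrow> ((\<lambda>t. \<Prod>i\<in>J. z - r i t) has_vector_derivative
        poly (root_poly_var J (\<lambda>i. r i s) (\<lambda>i. v i s)) z) (at s within I)"
    and eq: "\<And>i. i \<in> J \<Longrightarrow> r i t0 = r j t0 \<Longrightarrow> v i t0 = v j t0"
  shows "(r j has_vector_derivative v j t0) (at t0 within I)"
  unfolding has_vector_derivative_iff_tendsto tendsto_iff eventually_at
proof (intro allI impI)
  fix \<epsilon> :: real assume \<epsilon>: "\<epsilon> > 0"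
  define r0 v0 where "r0 = r j t0" and "v0 = v j t0"
  define C U where "C = {i\<in>J. r i t0 = r0}" and "U = J - C"
  have CO: "C \<union> U = J" "C \<inter> U = {}" "finite C" "finite U" "j \<in> C"
    using J by (auto simp: C_def U_def r0_def)
  \<comment> \<open>Of the extra 2, one unit absorbs the motion of \<open>r i\<close> and one that
    of the test point; the extra 1 in \<open>V\<close> absorbs the variation of the
    velocities.\<close>
  define M where "M = 2 + (\<Sum>i\<in>J. cmod (r0 - r i t0))"
  define V where "V = 1 + (\<Sum>i\<in>J. cmod (v i t0 - v0))"
  have Mi: "cmod (r0 - r i t0) \<le> M - 2" if "i \<in> J" for i
    unfolding M_def using member_le_sum[OF that, of "\<lambda>i. cmod (r0 - r i t0)"] J by simp
  have Vi: "cmod (v i t0 - v0) \<le> V - 1" if "i \<in> J" for i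
    unfolding V_def using member_le_sum[OF that, of "\<lambda>i. cmod (v i t0 - v0)"] J by simp
  have M1: "M \<ge> 1" and V1: "V \<ge> 1" by (simp_all add: M_def V_def add_increasing2 sum_nonneg)
  \<comment> \<open>Half of the value at displacement 0, so that the strict lower bound survives for
    small displacements.\<close>
  define \<kappa> where "\<kappa> = cmod (\<Prod>i\<in>U. r0 - r i t0) / 2"
  have \<kappa>0: "\<kappa> > 0"
    using CO by (auto simp: \<kappa>_def U_def C_def r0_def prod_zero_iff)
  \<comment> \<open>Collects the factors of the bound in \<open>roots_stay_close\<close> that are
    independent of \<rho>, \<delta> and \<open>V\<close>. The choice of \<delta> below makes the
    cluster contribute \<open>\<kappa> / 8\<close>.\<close>
  define D where "D = card J * M ^ card U * 2 ^ card C"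
  have D0: "D > 0" using M1 J unfolding D_def by (intro mult_pos_pos) (auto simp: card_gt_0_iff)
  define \<delta> where "\<delta> = \<epsilon> * \<kappa> / (4 * D)"
  have \<delta>0: "\<delta> > 0" using \<epsilon> \<kappa>0 D0 by (simp add: \<delta>_def)
  obtain d1 where d1: "d1 > 0" "\<And>i t. i \<in> J \<Longrightarrow> t \<in> I \<Longrightarrow> \<bar>t - t0\<bar> < d1 \<Longrightarrow> cmod (r i t - r i t0) < 1"
    using finite_family_close_within[of J I r t0 1] J(1) contr I(2) by auto
  obtain d2 where d2: "d2 > 0"
    "\<And>i t. i \<in> J \<Longrightarrow> t \<in> I \<Longrightarrow> \<bar>t - t0\<bar> < d2 \<Longrightarrow> cmod (v i t - v i t0) < min \<delta> 1"
    using finite_family_close_within[of J I v t0 "min \<delta> 1"] J(1) contv I(2) \<delta>0 by auto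
  have "((\<lambda>u. cmod (\<Prod>i\<in>U. r0 + u - r i t0)) \<longlongrightarrow> cmod (\<Prod>i\<in>U. r0 + 0 - r i t0)) (nhds 0)"
    by (intro tendsto_intros filterlim_ident)
  then have "\<forall>\<^sub>F u in nhds 0. \<kappa> < cmod (\<Prod>i\<in>U. r0 + u - r i t0)"
    by (rule order_tendstoD(1)) (use \<kappa>0 in \<open>simp add: \<kappa>_def del: zero_less_norm_iff\<close>)
  then obtain d3 where d3: "d3 > 0" "\<And>u. cmod u < d3 \<Longrightarrow> \<kappa> < cmod (\<Prod>i\<in>U. r0 + u - r i t0)"
    by (auto simp: eventually_nhds_metric)
  \<comment> \<open>\<open>d1\<close> and \<open>d2\<close> control the motion of roots and
    velocities, \<open>d3 / \<epsilon>\<close> the lower bound \<kappa>; the fourth entry limits the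
    contribution of \<open>U\<close> to \<open>\<kappa> / 4\<close>, the last one keeps the test
    point within distance 1 of \<open>r0\<close>.\<close>
  define d where "d = Min {d1, d2, d3 / \<epsilon>, \<kappa> / (4 * D * V), 1 / (\<epsilon> + cmod v0)}"
  have d: "d \<le> d1" "d \<le> d2" "d \<le> d3 / \<epsilon>" "d \<le> \<kappa> / (4 * D * V)" "d \<le> 1 / (\<epsilon> + cmod v0)" "d > 0"
    using d1(1) d2(1) d3(1) \<epsilon> \<kappa>0 D0 V1 by (auto simp: d_def add_pos_nonneg)
  show "\<exists>d>0. \<forall>t\<in>I. t \<noteq> t0 \<and> dist t t0 < d \<longrightarrow> dist ((r j t - r j t0) /\<^sub>R (t - t0)) (v j t0) < \<epsilon>"
  proof (intro exI[of _ d] conjI ballI impI)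
    fix t assume t: "t \<in> I" "t \<noteq> t0 \<and> dist t t0 < d"
    define \<tau> where "\<tau> = \<bar>t - t0\<bar>"
    have \<tau>: "\<tau> > 0" "\<tau> < d" using t by (auto simp: \<tau>_def dist_real_def)
    have seg: "closed_segment t0 t \<subseteq> I"
      using I t by (intro closed_segment_subset) (auto simp: is_interval_convex)
    have segd: "\<bar>s - t0\<bar> \<le> \<tau>" if "s \<in> closed_segment t0 t" for s
      using segment_bound1[OF that] by (simp add: \<tau>_def)
    have "\<tau> < d3 / \<epsilon>" using \<tau> d(3) by simp
    then have \<tau>3: "\<epsilon> * \<tau> < d3" using \<epsilon> by (simp add: field_simps)
    have \<tau>5: "\<epsilon> * \<tau> + \<tau> * cmod v0 \<le> 1"
    proof -
      have "\<tau> \<le> 1 / (\<epsilon> + cmod v0)" using \<tau> d(5) by simp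
      moreover have "\<epsilon> + cmod v0 > 0" using \<epsilon> by (simp add: add_pos_nonneg)
      ultimately show ?thesis by (simp add: field_simps)
    qed
    have vd: "cmod (v i s - v i t0) < min \<delta> 1" if "i \<in> J" "s \<in> closed_segment t0 t" for i s
      using d2(2)[OF that(1), of s] segd[OF that(2)] seg that \<tau> d(2) by auto
    have "cmod (r j t - r0 - (t - t0) *\<^sub>R v0) < \<epsilon> * \<tau>"
    proof (rule roots_stay_close[where C = C and U = U and v = v and M = M and V = V and X = X and
        \<kappa> = \<kappa> and I = I and \<delta> = \<delta>, OF seg])
      show "cmod (v i s - v0) \<le> \<delta>" if "i \<in> C" "s \<in> closed_segment t0 t" for i s
        using vd[of i s] eq[of i] that by (auto simp: C_def r0_def v0_def)
      show "cmod (v i s - v0) \<le> V" if "i \<in> U" "s \<in> closed_segment t0 t" for i s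
        using vd[of i s] Vi[of i] that norm_triangle_ineq[of "v i s - v i t0" "v i t0 - v0"]
        by (auto simp: U_def)
      show "cmod (r0 + (s - t0) *\<^sub>R v0 + u - r i s) \<le> M"
        if "i \<in> U" "s \<in> closed_segment t0 t" "cmod u \<le> \<epsilon> * \<tau>" for i s u
      proof -
        have iJ: "i \<in> J" using that by (simp add: U_def)
        have "r0 + (s - t0) *\<^sub>R v0 + u - r i s =
            (r0 - r i t0) - (r i s - r i t0) + ((s - t0) *\<^sub>R v0 + u)" by simp
        also have "cmod \<dots> \<le> cmod (r0 - r i t0) + cmod (r i s - r i t0) + (cmod ((s - t0) *\<^sub>R v0) + cmod u)"
          by (intro order_trans[OF norm_triangle_ineq] add_mono norm_triangle_ineq4 norm_triangle_ineq)
        also have "\<dots> \<le> (M - 2) + 1 + (\<tau> * cmod v0 + \<epsilon> * \<tau>)"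
          using Mi[OF iJ] d1(2)[OF iJ, of s] segd[OF that(2)] that seg \<tau> d(1)
          by (intro add_mono) (auto simp: mult_right_mono)
        also have "\<dots> \<le> M" using \<tau>5 by simp
        finally show ?thesis .
      qed
      show "\<kappa> < cmod (\<Prod>i\<in>U. r0 + u - r i t0)" if "cmod u \<le> \<epsilon> * \<tau>" for u
        using that \<tau>3 d3(2) by auto
      show "\<bar>t - t0\<bar> * (card (C \<union> U) * (M ^ card U *
          (\<delta> * (2 * (\<epsilon> * \<tau>)) ^ (card C - 1) + V * (2 * (\<epsilon> * \<tau>)) ^ card C))) \<le> \<kappa> * (\<epsilon> * \<tau>) ^ card C"
      proof -
        obtain c where c: "card C = Suc c" using CO by (metis card_gt_0_iff empty_iff gr0_implies_Suc)
        have "\<bar>t - t0\<bar> * (card (C \<union> U) * (M ^ card U *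
          (\<delta> * (2 * (\<epsilon> * \<tau>)) ^ (card C - 1) + V * (2 * (\<epsilon> * \<tau>)) ^ card C))) =
          (D * \<delta> / (2 * \<epsilon>) + \<tau> * (D * V)) * (\<epsilon> * \<tau>) ^ card C"
          using \<epsilon> by (simp add: CO c D_def \<tau>_def[symmetric] field_simps)
        also have "\<dots> \<le> (\<kappa> / 8 + \<kappa> / 4) * (\<epsilon> * \<tau>) ^ card C"
        proof (intro mult_right_mono add_mono)
          show "D * \<delta> / (2 * \<epsilon>) \<le> \<kappa> / 8" using D0 \<epsilon> by (simp add: \<delta>_def)
          have "\<tau> \<le> \<kappa> / (4 * D * V)" using \<tau> d by simp
          then show "\<tau> * (D * V) \<le> \<kappa> / 4" using D0 V1 by (simp add: field_simps)
        qed (use \<epsilon> \<tau> in simp)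
        also have "\<dots> \<le> \<kappa> * (\<epsilon> * \<tau>) ^ card C"
          using \<kappa>0 \<epsilon> \<tau> by (intro mult_right_mono) auto
        finally show ?thesis .
      qed
    qed (use CO contr X der \<epsilon> \<tau> V1 M1 in \<open>auto simp: C_def U_def\<close>)
    then have "cmod (r j t - r0 - (t - t0) *\<^sub>R v0) / \<tau> < \<epsilon>"
      using \<tau> by (simp add: field_simps)
    moreover have "(r j t - r0) /\<^sub>R (t - t0) - v0 = (r j t - r0 - (t - t0) *\<^sub>R v0) /\<^sub>R (t - t0)"
      using t by (simp add: scaleR_diff_right)
    ultimately show "dist ((r j t - r j t0) /\<^sub>R (t - t0)) (v j t0) < \<epsilon>"
      by (simp add: dist_norm r0_def v0_def \<tau>_def divide_inverse mult.commute)
  qed (fact d)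
qed

section \<open>The velocity of a Polubarinova-Galin solution\<close>

lemma time_interval_not_bot:
  assumes "time_interval I" "t \<in> I"
  shows "at t within I \<noteq> bot"
proof -
  obtain a b where ab: "a \<in> I" "b \<in> I" "a < b" using assms(1) by (auto simp: time_interval_def)
  have "connected I" using assms(1) by (simp add: time_interval_def is_interval_connected)
  moreover have "I \<noteq> {t}" using ab by auto
  ultimately show ?thesis
    using connected_imp_perfect[of I t] assms(2) by (auto simp: trivial_limit_within)
qed

lemma smooth_in_time_has_vector_derivative:
  assumes "smooth_in_time I f" "z \<in> cball 0 1" "t \<in> I"
  shows "(f z has_vector_derivative time_deriv I f z t) (at t within I)"
  using assms by (simp add: smooth_in_time_def vector_derivative_works[symmetric])

lemma smooth_in_time_continuous:
  assumes "smooth_in_time I f" "t \<in> I"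
  shows "continuous_on (cball 0 1) (\<lambda>z. time_deriv I f z t)"
proof -
  have "continuous_on (cball 0 1 \<times> I) (\<lambda>(z, t). time_deriv I f z t)"
    using assms by (simp add: smooth_in_time_def)
  from continuous_on_compose2[OF this, of "cball 0 1" "\<lambda>z. (z, t)"] show ?thesis
    using assms by (simp add: image_subset_iff continuous_intros)
qed

text \<open>Differentiation under the integral, justified by joint continuity of the time derivative
  on the closed disk times \<open>I\<close>. The powers 1 and 2 give the Cauchy integrals of
  \<open>f\<close> and of its space derivative.\<close>

lemma contour_integral_has_time_derivative:
  assumes I: "time_interval I" "t \<in> I" and smooth: "smooth_in_time I f"
    and ana: "\<And>t. t \<in> I \<Longrightarrow> (\<lambda>z. f z t) analytic_on cball 0 1"
    and z: "z \<in> ball 0 1"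
  shows "((\<lambda>s. contour_integral (circlepath 0 1) (\<lambda>u. f u s / (u - z) ^ k)) has_vector_derivative
     contour_integral (circlepath 0 1) (\<lambda>u. time_deriv I f u t / (u - z) ^ k)) (at t within I)"
proof -
  define \<gamma> where "\<gamma> = circlepath 0 1"
  define \<gamma>' where "\<gamma>' x = vector_derivative \<gamma> (at x)" for x
  have \<gamma>: "cmod (\<gamma> x) = 1" for x by (simp add: \<gamma>_def circlepath)
  have nz: "\<gamma> x - z \<noteq> 0" for x using \<gamma>[of x] z by auto
  have c\<gamma>: "continuous_on S \<gamma>" for S
    unfolding \<gamma>_def circlepath by (intro continuous_intros)
  have c\<gamma>': "continuous_on S \<gamma>'" for S
    unfolding \<gamma>'_def \<gamma>_def vector_derivative_circlepath by (intro continuous_intros)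
  have "((\<lambda>s. integral (cbox 0 1) (\<lambda>x. f (\<gamma> x) s / (\<gamma> x - z) ^ k * \<gamma>' x)) has_vector_derivative
      integral (cbox 0 1) (\<lambda>x. time_deriv I f (\<gamma> x) t / (\<gamma> x - z) ^ k * \<gamma>' x)) (at t within I)"
  proof (rule leibniz_rule_vector_derivative)
    show "((\<lambda>s. f (\<gamma> x) s / (\<gamma> x - z) ^ k * \<gamma>' x) has_vector_derivative
        time_deriv I f (\<gamma> x) s / (\<gamma> x - z) ^ k * \<gamma>' x) (at s within I)" if "s \<in> I" for s x
      using has_vector_derivative_mult_left[OF smooth_in_time_has_vector_derivative[OF smooth _ that, of "\<gamma> x"],
          of "\<gamma>' x / (\<gamma> x - z) ^ k"] \<gamma> by simp
    show "(\<lambda>x. f (\<gamma> x) s / (\<gamma> x - z) ^ k * \<gamma>' x) integrable_on cbox 0 1" if "s \<in> I" for s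
    proof (rule integrable_continuous, intro continuous_intros)
      have "continuous_on (cball 0 1) (\<lambda>z. f z s)"
        by (intro holomorphic_on_imp_continuous_on analytic_imp_holomorphic ana that)
      then show "continuous_on (cbox 0 1) (\<lambda>x. f (\<gamma> x) s)"
        by (rule continuous_on_compose2[OF _ c\<gamma>]) (auto simp: \<gamma>)
    qed (use nz c\<gamma> c\<gamma>' in auto)
    have "continuous_on (I \<times> cbox 0 1) (\<lambda>(s, x). time_deriv I f (\<gamma> x) s)"
    proof -
      have 1: "continuous_on (cball 0 1 \<times> I) (\<lambda>(z, t). time_deriv I f z t)"
        using smooth by (simp add: smooth_in_time_def)
      have 2: "continuous_on (I \<times> cbox 0 1) (\<lambda>(s, x). (\<gamma> x, s))"
        unfolding split_beta by (intro continuous_intros continuous_on_compose2[OF c\<gamma>[of UNIV]]) auto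
      show ?thesis using continuous_on_compose2[OF 1 2] by (simp add: split_beta image_subset_iff \<gamma>)
    qed
    then show "continuous_on (I \<times> cbox 0 1) (\<lambda>(s, x). time_deriv I f (\<gamma> x) s / (\<gamma> x - z) ^ k * \<gamma>' x)"
      unfolding split_beta using nz
      by (intro continuous_intros continuous_on_compose2[OF c\<gamma>[of UNIV]] continuous_on_compose2[OF c\<gamma>'[of UNIV]]) auto
    show "convex I" using I by (simp add: time_interval_def is_interval_convex)
  qed (fact I)
  then show ?thesis
    by (simp add: contour_integral_integral \<gamma>_def \<gamma>'_def)
qed

text \<open>\<open>f\<close> and its space derivative are Cauchy integrals over the unit circle.
  Differentiating them in time under the integral makes the time derivative a Cauchy integral of its
  own boundary values, hence holomorphic, and shows that the space and time derivatives
  commute.\<close>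

lemma time_deriv_holomorphic:
  assumes I: "time_interval I" "t \<in> I" and smooth: "smooth_in_time I f"
    and ana: "\<And>t. t \<in> I \<Longrightarrow> (\<lambda>z. f z t) analytic_on cball 0 1"
  shows "(\<lambda>z. time_deriv I f z t) holomorphic_on ball 0 1" (is ?th1)
    and "z \<in> ball 0 1 \<Longrightarrow>
      (space_deriv f z has_vector_derivative deriv (\<lambda>w. time_deriv I f w t) z) (at t within I)" (is "_ \<Longrightarrow> ?th2")
proof -
  define ci where "ci h w k = contour_integral (circlepath 0 1) (\<lambda>u. h u / (u - w) ^ k)"
    for h :: "complex \<Rightarrow> complex" and w k
  define D where "D = (\<lambda>z. time_deriv I f z t)"
  have contD: "continuous_on (cball 0 1) D"
    unfolding D_def by (rule smooth_in_time_continuous[OF smooth I(2)])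
  have hol: "(\<lambda>z. f z s) holomorphic_on cball 0 1" if "s \<in> I" for s
    by (intro analytic_imp_holomorphic ana that)
  note contf = holomorphic_on_imp_continuous_on[OF hol]
  have holb: "(\<lambda>z. f z s) holomorphic_on ball 0 1" if "s \<in> I" for s
    using hol[OF that] by (rule holomorphic_on_subset) auto
  have f: "f w s = ci (\<lambda>z. f z s) w 1 / (2 * of_real pi * \<i>)" if "s \<in> I" "w \<in> ball 0 1" for s w
    using contour_integral_unique[OF Cauchy_integral_circlepath[OF contf holb, of s w]] that
    by (simp add: ci_def)
  have f': "space_deriv f w s = ci (\<lambda>z. f z s) w 2 / (2 * of_real pi * \<i>)" if "s \<in> I" "w \<in> ball 0 1" for s w
    using DERIV_imp_deriv[OF Cauchy_derivative_integral_circlepath(2)[OF contf holb, of s w]] that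
    by (simp add: ci_def)
  have dci: "((\<lambda>s. ci (\<lambda>z. f z s) w k / c) has_vector_derivative ci D w k / c) (at t within I)"
    if "w \<in> ball 0 1" for w k c
    unfolding ci_def D_def
    using has_vector_derivative_mult_left[OF contour_integral_has_time_derivative[OF I smooth ana that], of k "1 / c"] by simp
  \<comment> \<open>Both sides are time derivatives of \<open>f w\<close> at \<open>t\<close>;
    uniqueness holds because \<open>t\<close> is not isolated in \<open>I\<close>.\<close>
  have D: "D w = ci D w 1 / (2 * of_real pi * \<i>)" if "w \<in> ball 0 1" for w
  proof (rule vector_derivative_unique_within[OF time_interval_not_bot[OF I]])
    show "(f w has_vector_derivative D w) (at t within I)"
      unfolding D_def using that by (intro smooth_in_time_has_vector_derivative[OF smooth _ I(2)]) auto
    show "(f w has_vector_derivative ci D w 1 / (2 * of_real pi * \<i>)) (at t within I)"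
      by (rule has_vector_derivative_transform[OF I(2) f[OF _ that] dci[OF that]])
  qed
  have pim: "path_image (circlepath 0 1 :: real \<Rightarrow> complex) \<subseteq> cball 0 1" by auto
  have "((\<lambda>u. D u / (u - w) ^ 1) has_contour_integral ci D w 1) (circlepath 0 1)" if "w \<in> ball 0 1" for w
    unfolding ci_def
    by (intro has_contour_integral_integral contour_integrable_continuous_circlepath continuous_intros
         continuous_on_subset[OF contD pim]) (use that in auto)
  from Cauchy_next_derivative_circlepath(2)[OF continuous_on_subset[OF contD pim] this]
  have ciD: "((\<lambda>w. ci D w 1) has_field_derivative ci D w 2) (at w)" if "w \<in> ball 0 1" for w
    using that by (simp add: ci_def numeral_2_eq_2)
  have D': "(D has_field_derivative ci D w 2 / (2 * of_real pi * \<i>)) (at w)" if "w \<in> ball 0 1" for w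
    by (rule has_field_derivative_transform_within_open[OF DERIV_cdivide[OF ciD[OF that]] open_ball that])
       (simp add: D)
  show ?th1
    using D' unfolding D_def[symmetric] holomorphic_on_open[OF open_ball] by blast
  show ?th2 if "z \<in> ball 0 1"
    unfolding D_def[symmetric] DERIV_imp_deriv[OF D'[OF that]]
    by (rule has_vector_derivative_transform[OF I(2) f'[OF _ that] dci[OF that]])
qed

text \<open>The maximum principle for \<open>s\<close> and \<open>- s\<close> gives
  \<open>Re s = 0\<close> in the disk. An image inside a line is not open, so \<open>s\<close> is
  constant, and the condition at 0 fixes the constant.\<close>

lemma Re_eq_0_on_sphere_imp_0:
  assumes hol: "s holomorphic_on ball 0 1" and cont: "continuous_on (cball 0 1) s"
    and sph: "\<And>z. z \<in> sphere 0 1 \<Longrightarrow> Re (s z) = 0" and s0: "Im (s 0) = 0"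
    and z: "z \<in> cball 0 1"
  shows "s z = 0"
proof -
  have le: "Re (h w) \<le> 0"
    if "h holomorphic_on ball 0 1" "continuous_on (cball 0 1) h" "\<And>z. z \<in> sphere 0 1 \<Longrightarrow> Re (h z) = 0"
      "w \<in> cball 0 1" for h w
    by (rule maximum_real_frontier[of h "cball 0 1"]) (use that in auto)
  have Re0: "Re (s w) = 0" if "w \<in> cball 0 1" for w
    using le[OF hol cont sph that] le[of "\<lambda>z. - s z" w] hol cont sph that
    by (auto intro!: holomorphic_intros continuous_intros)
  have "s constant_on ball 0 1"
  proof (rule ccontr)
    assume "\<not> s constant_on ball 0 1"
    then have "open (s ` ball 0 1)"
      by (intro open_mapping_thm[OF hol]) auto
    moreover have "s ` ball 0 1 \<subseteq> {z. Re z = 0}" using Re0 by auto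
    ultimately have "s ` ball 0 1 \<subseteq> interior {z. Re z = 0}" by (simp add: interior_maximal)
    also have "\<dots> = {}" 
    using interior_hyperplane[of "1 :: complex" 0] by (simp add: inner_complex_def)
    finally show False by simp
  qed
  then obtain c where c: "\<And>w. w \<in> ball 0 1 \<Longrightarrow> s w = c" by (auto simp: constant_on_def)
  have "c = 0" using c[of 0] Re0[of 0] s0 by (simp add: complex_eq_iff)
  then show ?thesis
    using continuous_constant_on_closure[of "ball 0 1" s 0 z] cont c z by auto
qed

text \<open>The quotient of the time derivative by \<open>z * space_deriv f z t\<close> and
  \<open>p\<close> have the same real part on the circle. Both normalisations of \<open>f\<close>
  enter at the origin: \<open>f 0 t = 0\<close> for all times makes the singularity removable, and a
  real space derivative at 0 for all times makes the value there real.\<close>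

lemma PG_velocity:
  assumes sol: "locally_univalent_PG_solution I q f" and t: "t \<in> I"
    and hol: "p holomorphic_on ball 0 1" and cont: "continuous_on (cball 0 1) p"
    and Re_p: "\<And>z. cmod z = 1 \<Longrightarrow> Re (p z) = q t / (cmod (space_deriv f z t))\<^sup>2" and p0: "Im (p 0) = 0"
    and z: "z \<in> cball 0 1"
  shows "time_deriv I f z t = z * space_deriv f z t * p z"
proof -
  define D where "D z = time_deriv I f z t" for z
  define g where "g z = space_deriv f z t" for z
  have ti: "time_interval I" and smooth: "smooth_in_time I f"
    and ana: "\<And>t. t \<in> I \<Longrightarrow> (\<lambda>z. f z t) analytic_on cball 0 1"
    and f0: "\<And>t. t \<in> I \<Longrightarrow> f 0 t = 0"
    and g0: "\<And>t. t \<in> I \<Longrightarrow> Im (space_deriv f 0 t) = 0"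
    and gnz: "\<And>z. z \<in> cball 0 1 \<Longrightarrow> g z \<noteq> 0"
    and PG: "\<And>z. cmod z = 1 \<Longrightarrow> Re (D z * cnj (z * g z)) = q t"
    using sol t by (auto simp: locally_univalent_PG_solution_def g_def D_def complex_is_Real_iff)
  note nbot = time_interval_not_bot[OF ti t]
  have contD: "continuous_on (cball 0 1) D"
    using smooth_in_time_continuous[OF smooth t] by (simp add: D_def[abs_def])
  have holD: "D holomorphic_on ball 0 1"
    using time_deriv_holomorphic(1)[OF ti t smooth ana] by (simp add: D_def[abs_def])
  have "g analytic_on cball 0 1"
    using analytic_deriv[OF ana[OF t]] by (simp add: g_def[abs_def])
  then have holg: "g holomorphic_on cball 0 1" by (rule analytic_imp_holomorphic)
  then have contg: "continuous_on (cball 0 1) g" and holgb: "g holomorphic_on ball 0 1"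
    by (auto intro: holomorphic_on_imp_continuous_on holomorphic_on_subset)
  have D0: "D 0 = 0"
  proof (rule vector_derivative_unique_within[OF nbot])
    show "(f 0 has_vector_derivative D 0) (at t within I)"
      unfolding D_def by (rule smooth_in_time_has_vector_derivative[OF smooth _ t]) simp
    show "(f 0 has_vector_derivative 0) (at t within I)"
      by (rule has_vector_derivative_transform[OF t f0 has_vector_derivative_const])
  qed
  have D'0: "Im (deriv D 0) = 0"
  proof (rule vector_derivative_unique_within[OF nbot])
    have "(space_deriv f 0 has_vector_derivative deriv D 0) (at t within I)"
      using time_deriv_holomorphic(2)[OF ti t smooth ana, of 0] by (simp add: D_def[abs_def])
    then show "((\<lambda>s. Im (space_deriv f 0 s)) has_vector_derivative Im (deriv D 0)) (at t within I)"
      by (rule bounded_linear.has_vector_derivative[OF bounded_linear_Im])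
    show "((\<lambda>s. Im (space_deriv f 0 s)) has_vector_derivative 0) (at t within I)"
      by (rule has_vector_derivative_transform[OF t g0 has_vector_derivative_const])
  qed
  define r where "r z = D z / g z - z * p z" for z
  have holr: "r holomorphic_on ball 0 1"
    unfolding r_def using gnz
    by (intro holomorphic_on_diff holomorphic_on_divide holomorphic_on_mult holomorphic_on_ident holD holgb hol) auto
  have contr: "continuous_on (cball 0 1) r"
    unfolding r_def by (intro continuous_on_diff continuous_on_divide continuous_on_mult continuous_on_id contD contg cont ballI gnz)
  have r0: "r 0 = 0" by (simp add: r_def D0)
  \<comment> \<open>Away from 0 this is \<open>D z / (z * g z) - p z\<close>;
    \<open>deriv r 0\<close> fills the removable singularity.\<close>
  define s where "s z = (if z = 0 then deriv r 0 else (r z - r 0) / (z - 0))" for z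
  have hols: "s holomorphic_on ball 0 1"
    unfolding s_def by (rule pole_lemma_open[OF holr open_ball])
  have conts: "continuous_on (cball 0 1) s"
    unfolding continuous_on_eq_continuous_within
  proof
    fix x :: complex assume x: "x \<in> cball 0 1"
    show "continuous (at x within cball 0 1) s"
    proof (cases "x = 0")
      case True
      have "isCont s 0"
        by (rule continuous_on_interior[OF holomorphic_on_imp_continuous_on[OF hols]]) simp
      then show ?thesis
        unfolding True by (rule continuous_at_imp_continuous_at_within)
    next
      case False
      have "continuous_on (cball 0 1 - {0}) r"
        by (rule continuous_on_subset[OF contr]) auto
      then have "continuous_on (cball 0 1 - {0}) (\<lambda>z. (r z - r 0) / (z - 0))"
        by (intro continuous_on_diff continuous_on_divide continuous_on_const continuous_on_id) auto
      then have "continuous_on (cball 0 1 - {0}) s"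
        by (rule continuous_on_eq) (simp add: s_def)
      then have "continuous (at x within cball 0 1 - {0}) s"
        using x False by (simp add: continuous_on_eq_continuous_within)
      moreover have "at x within cball 0 1 - {0} = at x within cball 0 1"
        by (rule at_within_nhd[of _ "- {0}"]) (use False in auto)
      ultimately show ?thesis by simp
    qed
  qed
  have "s z = 0"
  proof (rule Re_eq_0_on_sphere_imp_0[OF hols conts _ _ z])
    fix w :: complex assume "w \<in> sphere 0 1"
    then have w: "cmod w = 1" by simp
    then have w0: "w \<noteq> 0" and gw: "g w \<noteq> 0" using gnz[of w] by auto
    have "s w = D w * cnj (w * g w) / of_real ((cmod (w * g w))\<^sup>2) - p w"
      using w0 gw unfolding complex_norm_square by (simp add: s_def r0) (simp add: r_def field_simps)
    then have "Re (s w) = Re (D w * cnj (w * g w)) / (cmod (w * g w))\<^sup>2 - Re (p w)"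
      by (simp only: Re_divide_of_real minus_complex.simps)
    then show "Re (s w) = 0"
      using PG[OF w] Re_p[OF w] w by (simp add: norm_mult g_def)
  next
    have hd: "(h has_field_derivative deriv h 0) (at 0)" if "h holomorphic_on ball 0 1" for h
      using holomorphic_derivI[OF that open_ball, of 0] by simp
    have g00: "g 0 \<noteq> 0" using gnz[of 0] by simp
    have "(r has_field_derivative ((deriv D 0 * g 0 - D 0 * deriv g 0) / (g 0 * g 0) - (1 * p 0 + deriv p 0 * 0))) (at 0)"
      unfolding r_def by (intro DERIV_diff DERIV_divide DERIV_mult hd holD holgb hol DERIV_ident g00)
    then have "s 0 = deriv D 0 / g 0 - p 0"
      using g00 by (simp add: s_def DERIV_imp_deriv D0)
    moreover have "Im (g 0) = 0" using g0[OF t] by (simp add: g_def)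
    ultimately show "Im (s 0) = 0"
      using p0 D'0 by (simp add: Im_divide)
  qed
  show ?thesis
  proof (cases "z = 0")
    case True
    then show ?thesis using D0 by (simp add: D_def)
  next
    case False
    then have "r z = 0" using \<open>s z = 0\<close> by (simp add: s_def r0)
    then show ?thesis using gnz[OF z] by (simp add: r_def D_def g_def field_simps)
  qed
qed

section \<open>Partial fractions\<close>

lemma sum_offdiag_swap:
  assumes "finite K"
  shows "(\<Sum>i\<in>K. \<Sum>k\<in>K - {i}. h i k) = (\<Sum>i\<in>K. \<Sum>k\<in>K - {i}. h k i :: complex)"
proof -
  have *: "(\<Sum>k\<in>K - {i}. g k) = (\<Sum>k\<in>K. if k = i then 0 else g k)" for i and g :: "_ \<Rightarrow> complex"
    using assms by (intro sum.mono_neutral_cong_left) auto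
  show ?thesis unfolding * by (subst sum.swap) (simp add: eq_commute)
qed

text \<open>
  In the application \<open>p\<close> is the quotient \<open>\<partial>f/\<partial>t / (z g)\<close>, and the left-hand side is the
  logarithmic time derivative of \<open>g\<close>.
\<close>

lemma log_time_derivative_identity:
  fixes \<omega> A :: "'i \<Rightarrow> complex" and \<zeta> :: "'j \<Rightarrow> complex" and K :: "'i set" and A0 z :: complex
  defines "p \<equiv> \<lambda>z. A0 + (\<Sum>k\<in>K. 2 * A k / (z - \<omega> k))"
  assumes fin: "finite K" "finite J" and inj: "inj_on \<omega> K" and nc: "\<And>k j. k \<in> K \<Longrightarrow> j \<in> J \<Longrightarrow> \<omega> k \<noteq> \<zeta> j"
    and nz: "\<And>k. k \<in> K \<Longrightarrow> \<omega> k \<noteq> 0"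
    and z\<omega>: "\<And>k. k \<in> K \<Longrightarrow> z \<noteq> \<omega> k" and z\<zeta>: "\<And>j. j \<in> J \<Longrightarrow> z \<noteq> \<zeta> j"
  shows "z * p z * ((\<Sum>k\<in>K. 1 / (z - \<omega> k)) - (\<Sum>j\<in>J. 1 / (z - \<zeta> j)))
      + (p z - z * (\<Sum>k\<in>K. 2 * A k / (z - \<omega> k)\<^sup>2)) =
    (of_nat (card K) - of_nat (card J) + 1) * A0
      + (\<Sum>k\<in>K. \<omega> k * (A0 + 2 * A k / \<omega> k + (\<Sum>j\<in>K - {k}. 2 * (A k + A j) / (\<omega> k - \<omega> j))
           - (\<Sum>j\<in>J. 2 * A k / (\<omega> k - \<zeta> j))) / (z - \<omega> k))
      - (\<Sum>j\<in>J. \<zeta> j * p (\<zeta> j) / (z - \<zeta> j))"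
proof -
  \<comment> \<open>Partial fractions in \<open>z\<close>: the residue at \<zeta>_j, the value
    \<open>A0\<close> at infinity, and the residues at the poles \<omega>_k of
    \<open>p\<close>.\<close>
  have pole: "z * p z / (z - \<zeta> j) =
      \<zeta> j * p (\<zeta> j) / (z - \<zeta> j) + A0 + (\<Sum>k\<in>K. \<omega> k / (z - \<omega> k) * (2 * A k / (\<omega> k - \<zeta> j)))" if j: "j \<in> J" for j
  proof -
    have "z * (2 * A k / (z - \<omega> k)) / (z - \<zeta> j) - \<zeta> j * (2 * A k / (\<zeta> j - \<omega> k)) / (z - \<zeta> j) =
        \<omega> k / (z - \<omega> k) * (2 * A k / (\<omega> k - \<zeta> j))" if k: "k \<in> K" for k
    proof -
      have "\<omega> k - \<zeta> j \<noteq> 0" "\<zeta> j - \<omega> k \<noteq> 0" "z - \<omega> k \<noteq> 0" "z - \<zeta> j \<noteq> 0"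
        using nc[OF k j] z\<omega>[OF k] z\<zeta>[OF j] by auto
      then show ?thesis by (simp add: divide_simps) (simp add: algebra_simps)
    qed
    then have "(\<Sum>k\<in>K. z * (2 * A k / (z - \<omega> k)) / (z - \<zeta> j)) - (\<Sum>k\<in>K. \<zeta> j * (2 * A k / (\<zeta> j - \<omega> k)) / (z - \<zeta> j)) =
        (\<Sum>k\<in>K. \<omega> k / (z - \<omega> k) * (2 * A k / (\<omega> k - \<zeta> j)))"
      unfolding sum_subtractf[symmetric] by (rule sum.cong[OF refl])
    moreover have "z * A0 / (z - \<zeta> j) - \<zeta> j * A0 / (z - \<zeta> j) = A0"
      using z\<zeta>[OF j] by (simp add: diff_divide_distrib[symmetric] left_diff_distrib[symmetric])
    ultimately show ?thesis
      by (simp add: p_def distrib_left add_divide_distrib sum_distrib_left sum_divide_distrib algebra_simps)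
  qed
  have "z * p z * (\<Sum>j\<in>J. 1 / (z - \<zeta> j)) = (\<Sum>j\<in>J. z * p z / (z - \<zeta> j))"
    by (simp add: sum_distrib_left)
  also have "\<dots> = (\<Sum>j\<in>J. \<zeta> j * p (\<zeta> j) / (z - \<zeta> j)) + of_nat (card J) * A0 +
      (\<Sum>j\<in>J. \<Sum>k\<in>K. \<omega> k / (z - \<omega> k) * (2 * A k / (\<omega> k - \<zeta> j)))"
    using pole by (simp add: sum.distrib)
  also have "(\<Sum>j\<in>J. \<Sum>k\<in>K. \<omega> k / (z - \<omega> k) * (2 * A k / (\<omega> k - \<zeta> j))) =
      (\<Sum>k\<in>K. \<omega> k / (z - \<omega> k) * (\<Sum>j\<in>J. 2 * A k / (\<omega> k - \<zeta> j)))"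
    by (subst sum.swap) (simp add: sum_distrib_left)
  finally have poles: "z * p z * (\<Sum>j\<in>J. 1 / (z - \<zeta> j)) =
      (\<Sum>j\<in>J. \<zeta> j * p (\<zeta> j) / (z - \<zeta> j)) + of_nat (card J) * A0 +
      (\<Sum>k\<in>K. \<omega> k / (z - \<omega> k) * (\<Sum>j\<in>J. 2 * A k / (\<omega> k - \<zeta> j)))" .

  \<comment> \<open>\<open>h i k\<close> and \<open>h' i k\<close> are the parts with poles at
    \<omega>_k and \<omega>_i of \<open>z * 2 * A k / ((z - \<omega> k) * (z - \<omega> i))\<close>.
    After exchanging the indices in \<open>h\<close>, both have their pole at \<omega>_i, and their
    sum carries the symmetric numerator \<open>A i + A k\<close>.\<close>
  define h where "h i k = 2 * A k * \<omega> k / ((\<omega> k - \<omega> i) * (z - \<omega> k))" for i k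
  define h' where "h' i k = 2 * A k * \<omega> i / ((\<omega> i - \<omega> k) * (z - \<omega> i))" for i k
  \<comment> \<open>The term with the double pole at \<omega>_i is kept whole; summed over
    \<open>i\<close> it cancels against \<open>z\<close> times the derivative of
    \<open>p\<close>.\<close>
  have zero: "z * p z / (z - \<omega> i) = A0 + A0 * \<omega> i / (z - \<omega> i) + z * (2 * A i / (z - \<omega> i)\<^sup>2)
      + (\<Sum>k\<in>K - {i}. h i k) + (\<Sum>k\<in>K - {i}. h' i k)" if i: "i \<in> K" for i
  proof -
    have "z * (2 * A k / (z - \<omega> k)) / (z - \<omega> i) = h i k + h' i k" if k: "k \<in> K - {i}" for k
    proof -
      have "\<omega> k - \<omega> i \<noteq> 0" "\<omega> i - \<omega> k \<noteq> 0" "z - \<omega> k \<noteq> 0" "z - \<omega> i \<noteq> 0"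
        using inj_onD[OF inj, of k i] k i z\<omega>[of k] z\<omega>[OF i] by auto
      then show ?thesis unfolding h_def h'_def by (simp add: divide_simps) (simp add: algebra_simps)
    qed
    then have "(\<Sum>k\<in>K - {i}. z * (2 * A k / (z - \<omega> k)) / (z - \<omega> i)) = (\<Sum>k\<in>K - {i}. h i k) + (\<Sum>k\<in>K - {i}. h' i k)"
      unfolding sum.distrib[symmetric] by (rule sum.cong[OF refl])
    moreover have "z * A0 / (z - \<omega> i) = A0 + A0 * \<omega> i / (z - \<omega> i)"
      using z\<omega>[OF i] by (simp add: field_simps)
    moreover have "z * p z / (z - \<omega> i) = z * A0 / (z - \<omega> i) + (z * (2 * A i / (z - \<omega> i)) / (z - \<omega> i)
        + (\<Sum>k\<in>K - {i}. z * (2 * A k / (z - \<omega> k)) / (z - \<omega> i)))"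
      using fin i by (subst sum.remove[symmetric])
        (auto simp: p_def distrib_left add_divide_distrib sum_distrib_left sum_divide_distrib)
    ultimately show ?thesis by (simp add: power2_eq_square)
  qed
  have "z * p z * (\<Sum>k\<in>K. 1 / (z - \<omega> k)) = (\<Sum>i\<in>K. z * p z / (z - \<omega> i))"
    by (simp add: sum_distrib_left)
  also have "\<dots> = of_nat (card K) * A0 + (\<Sum>i\<in>K. A0 * \<omega> i / (z - \<omega> i)) + z * (\<Sum>i\<in>K. 2 * A i / (z - \<omega> i)\<^sup>2)
      + (\<Sum>i\<in>K. \<Sum>k\<in>K - {i}. h i k) + (\<Sum>i\<in>K. \<Sum>k\<in>K - {i}. h' i k)"
    using zero by (simp add: sum.distrib sum_distrib_left)
  also have "(\<Sum>i\<in>K. \<Sum>k\<in>K - {i}. h i k) = (\<Sum>i\<in>K. \<Sum>k\<in>K - {i}. h k i)"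
    by (rule sum_offdiag_swap[OF fin(1)])
  finally have zeros: "z * p z * (\<Sum>k\<in>K. 1 / (z - \<omega> k)) - z * (\<Sum>i\<in>K. 2 * A i / (z - \<omega> i)\<^sup>2) =
      of_nat (card K) * A0 + (\<Sum>i\<in>K. A0 * \<omega> i / (z - \<omega> i))
      + (\<Sum>i\<in>K. \<Sum>k\<in>K - {i}. h k i) + (\<Sum>i\<in>K. \<Sum>k\<in>K - {i}. h' i k)" by simp

  \<comment> \<open>The summand \<open>2 * A i / (z - \<omega> i)\<close> is contributed by
    \<open>p z\<close> itself and becomes the term \<open>2 * A i / \<omega> i\<close> of the
    velocity.\<close>
  have "A0 * \<omega> i / (z - \<omega> i) + (\<Sum>k\<in>K - {i}. h k i) + (\<Sum>k\<in>K - {i}. h' i k) + 2 * A i / (z - \<omega> i) -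
      \<omega> i / (z - \<omega> i) * (\<Sum>j\<in>J. 2 * A i / (\<omega> i - \<zeta> j)) =
      \<omega> i * (A0 + 2 * A i / \<omega> i + (\<Sum>j\<in>K - {i}. 2 * (A i + A j) / (\<omega> i - \<omega> j))
           - (\<Sum>j\<in>J. 2 * A i / (\<omega> i - \<zeta> j))) / (z - \<omega> i)" if i: "i \<in> K" for i
  proof -
    have "h k i + h' i k = \<omega> i / (z - \<omega> i) * (2 * (A i + A k) / (\<omega> i - \<omega> k))" for k
      by (simp add: h_def h'_def add_divide_distrib[symmetric] algebra_simps)
    then have "(\<Sum>k\<in>K - {i}. h k i) + (\<Sum>k\<in>K - {i}. h' i k) =
        \<omega> i / (z - \<omega> i) * (\<Sum>k\<in>K - {i}. 2 * (A i + A k) / (\<omega> i - \<omega> k))"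
      unfolding sum.distrib[symmetric] sum_distrib_left by simp
    moreover have "\<omega> i * (2 * A i / \<omega> i) = 2 * A i" using nz[OF i] by simp
    ultimately show ?thesis
      by (simp add: distrib_left right_diff_distrib add_divide_distrib diff_divide_distrib mult.commute)
  qed
  then have "(\<Sum>i\<in>K. A0 * \<omega> i / (z - \<omega> i) + (\<Sum>k\<in>K - {i}. h k i) + (\<Sum>k\<in>K - {i}. h' i k) + 2 * A i / (z - \<omega> i) -
      \<omega> i / (z - \<omega> i) * (\<Sum>j\<in>J. 2 * A i / (\<omega> i - \<zeta> j))) =
      (\<Sum>i\<in>K. \<omega> i * (A0 + 2 * A i / \<omega> i + (\<Sum>j\<in>K - {i}. 2 * (A i + A j) / (\<omega> i - \<omega> j))
           - (\<Sum>j\<in>J. 2 * A i / (\<omega> i - \<zeta> j))) / (z - \<omega> i))"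
    by (rule sum.cong[OF refl])
  then have "(\<Sum>i\<in>K. A0 * \<omega> i / (z - \<omega> i)) + (\<Sum>i\<in>K. \<Sum>k\<in>K - {i}. h k i) + (\<Sum>i\<in>K. \<Sum>k\<in>K - {i}. h' i k)
      + (\<Sum>i\<in>K. 2 * A i / (z - \<omega> i)) - (\<Sum>i\<in>K. \<omega> i / (z - \<omega> i) * (\<Sum>j\<in>J. 2 * A i / (\<omega> i - \<zeta> j))) =
      (\<Sum>i\<in>K. \<omega> i * (A0 + 2 * A i / \<omega> i + (\<Sum>j\<in>K - {i}. 2 * (A i + A j) / (\<omega> i - \<omega> j))
           - (\<Sum>j\<in>J. 2 * A i / (\<omega> i - \<zeta> j))) / (z - \<omega> i))"
    unfolding sum_subtractf sum.distrib .
  moreover have "p z = A0 + (\<Sum>i\<in>K. 2 * A i / (z - \<omega> i))" by (simp add: p_def)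
  moreover have "(of_nat (card K) - of_nat (card J) + 1) * A0 = of_nat (card K) * A0 - of_nat (card J) * A0 + A0"
    by (simp add: algebra_simps)
  moreover have "x1 * (x2 - x3) + (pz - y) = c + w - v"
    if "a + h1 + h2 + r - u = w" "pz = A0 + r" "c = k - j + A0"
      "x1 * x2 - y = k + a + h1 + h2" "x1 * x3 = v + j + u"
    for x1 x2 x3 y k a h1 h2 v j u r w pz c :: complex
  proof -
    have "x1 * x2 = k + a + h1 + h2 + y" using that(4) by (simp add: diff_eq_eq)
    then show ?thesis
      unfolding right_diff_distrib that(1)[symmetric] that(2,3,5) by simp
  qed
  ultimately show ?thesis
    using zeros poles by blast
qed

section \<open>Reflection in the unit circle and the function q / |g|^2\<close>

lemma reflect_reflect [simp]: "reflect (reflect w) = w"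
  by (simp add: reflect_def)

text \<open>A linear factor of \<open>g\<^sup>*\<close> as a function of \<open>w\<close>: its zero
  is the reflected root, and it has a pole at 0.\<close>

lemma cnj_reflect_diff:
  assumes "w \<noteq> 0" "c \<noteq> 0"
  shows "cnj (reflect w - c) = (- cnj c) * (w - reflect c) / w"
  using assms by (simp add: reflect_def field_simps)

lemma prod_cnj_reflect_diff:
  assumes "w \<noteq> 0" "\<And>j. j \<in> J \<Longrightarrow> c j \<noteq> 0"
  shows "(\<Prod>j\<in>J. cnj (reflect w - c j)) = (\<Prod>j\<in>J. - cnj (c j)) * (\<Prod>j\<in>J. w - reflect (c j)) / w ^ card J"
proof -
  have "(\<Prod>j\<in>J. cnj (reflect w - c j)) = (\<Prod>j\<in>J. (- cnj (c j)) * (w - reflect (c j)) / w)"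
    using assms by (intro prod.cong refl cnj_reflect_diff) auto
  also have "\<dots> = (\<Prod>j\<in>J. - cnj (c j)) * (\<Prod>j\<in>J. w - reflect (c j)) / w ^ card J"
    by (simp only: prod_dividef prod.distrib prod_constant)
  finally show ?thesis .
qed

text \<open>
  The rational function \<open>q / (g g\<^sup>*)\<close> has simple poles at the zeros of \<open>g\<close>, with residues \<open>A k\<close>,
  and at their reflections, with residues determined by the symmetry \<open>R\<^sup>* = R\<close>.
\<close>

lemma partial_fractions_symmetric:
  fixes \<omega> :: "'i \<Rightarrow> complex" and \<zeta> :: "'j \<Rightarrow> complex" and q \<beta> :: complex and K :: "'i set" and J :: "'j set"
  defines "A \<equiv> \<lambda>k. q / \<beta> *
     (((\<Prod>j\<in>J. \<omega> k - \<zeta> j) * (\<Prod>j\<in>J. cnj (reflect (\<omega> k) - \<zeta> j))) /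
      ((\<Prod>j\<in>K - {k}. \<omega> k - \<omega> j) * (\<Prod>j\<in>K. cnj (reflect (\<omega> k) - \<omega> j))))"
    and "c \<equiv> q / \<beta> * (\<Prod>j\<in>J. - cnj (\<zeta> j)) / (\<Prod>k\<in>K. - cnj (\<omega> k))"
  assumes fin: "finite K" "finite J" and card: "card J \<le> card K" and inj: "inj_on \<omega> K"
    and \<omega>: "\<And>k. k \<in> K \<Longrightarrow> cmod (\<omega> k) > 1" and \<zeta>: "\<And>j. j \<in> J \<Longrightarrow> cmod (\<zeta> j) > 1"
    and q: "cnj q = q" "cnj \<beta> = \<beta>" and z: "cmod z \<le> 1" "\<And>k. k \<in> K \<Longrightarrow> z \<noteq> reflect (\<omega> k)"
  shows "c * (z ^ (card K - card J) * (\<Prod>j\<in>J. z - \<zeta> j) * (\<Prod>j\<in>J. z - reflect (\<zeta> j))) /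
      ((\<Prod>k\<in>K. z - \<omega> k) * (\<Prod>k\<in>K. z - reflect (\<omega> k))) =
    (if card K = card J then c else 0)
     + (\<Sum>k\<in>K. A k / (z - \<omega> k)) - (\<Sum>k\<in>K. cnj (A k) * (reflect (\<omega> k))\<^sup>2 / (z - reflect (\<omega> k)))"
proof -
  define d where "d = card K - card J"
  \<comment> \<open>Every linear factor of \<open>g\<^sup>*\<close> carries 1/z; clearing these
    leaves the power \<open>d\<close> in the numerator. The degree is
    \<open>card K + card J\<close>, against \<open>2 * card K\<close> in the denominator, so the
    value at infinity is nonzero at most for equal numbers of zeros and poles: the case distinction
    in \<open>A_infinity\<close>.\<close>
  define N where "N = smult c (monom 1 d * root_poly J \<zeta> * root_poly J (\<lambda>j. reflect (\<zeta> j)))"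
  define X where "X = \<omega> ` K \<union> (\<lambda>k. reflect (\<omega> k)) ` K"
  have \<omega>0: "\<omega> k \<noteq> 0" if "k \<in> K" for k using \<omega>[OF that] by auto
  have \<zeta>0: "\<zeta> j \<noteq> 0" if "j \<in> J" for j using \<zeta>[OF that] by auto
  have refl1: "cmod (reflect (\<omega> k)) < 1" if "k \<in> K" for k
    using \<omega>[OF that] by (simp add: reflect_def norm_divide divide_simps)
  have refl0: "reflect (\<omega> k) \<noteq> 0" if "k \<in> K" for k using \<omega>0[OF that] by (simp add: reflect_def)
  have injr: "inj_on (\<lambda>k. reflect (\<omega> k)) K"
    using inj by (auto simp: inj_on_def reflect_def)
  have disj: "\<omega> ` K \<inter> (\<lambda>k. reflect (\<omega> k)) ` K = {}"
  proof -
    have "\<omega> k \<noteq> reflect (\<omega> l)" if "k \<in> K" "l \<in> K" for k l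
      using \<omega>[OF that(1)] refl1[OF that(2)] by auto
    then show ?thesis by auto
  qed
  have finX: "finite X" using fin by (simp add: X_def)
  have cardX: "card X = card K + card K"
    unfolding X_def using fin disj by (subst card_Un_disjoint) (auto simp: card_image inj injr)
  have polyN: "poly N x = c * (x ^ d * (\<Prod>j\<in>J. x - \<zeta> j) * (\<Prod>j\<in>J. x - reflect (\<zeta> j)))" for x
    by (simp add: N_def poly_monom)
  have mon: "degree (monom 1 d * root_poly J \<zeta> * root_poly J (\<lambda>j. reflect (\<zeta> j))) = d + card J + card J"
    "lead_coeff (monom 1 d * root_poly J \<zeta> * root_poly J (\<lambda>j. reflect (\<zeta> j))) = 1"
  proof -
    have "root_poly J r \<noteq> 0" for r by (metis coeff_0 monic_root_poly zero_neq_one)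
    then show "degree (monom 1 d * root_poly J \<zeta> * root_poly J (\<lambda>j. reflect (\<zeta> j))) = d + card J + card J"
      by (simp add: degree_mult_eq degree_monom_eq monom_eq_0_iff)
    show "lead_coeff (monom 1 d * root_poly J \<zeta> * root_poly J (\<lambda>j. reflect (\<zeta> j))) = 1"
      by (simp only: lead_coeff_mult monic_root_poly lead_coeff_monom mult_1_right)
  qed
  have degN: "degree N \<le> card X"
    unfolding N_def using card by (intro order_trans[OF degree_smult_le], simp only: mon(1) cardX) (simp add: d_def)
  have coeffN: "coeff N (card X) = (if card K = card J then c else 0)"
  proof (cases "card K = card J")
    case True
    then show ?thesis using mon by (simp add: N_def cardX d_def)
  next
    case False
    have "degree (monom 1 d * root_poly J \<zeta> * root_poly J (\<lambda>j. reflect (\<zeta> j))) < card X"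
      unfolding mon using False card by (simp add: cardX d_def)
    then show ?thesis using False by (simp add: N_def coeff_eq_0)
  qed
  have zX: "z \<notin> X" unfolding X_def using z \<omega> by force
  have prodX: "(\<Prod>x\<in>X. h x) = (\<Prod>k\<in>K. h (\<omega> k)) * (\<Prod>k\<in>K. h (reflect (\<omega> k)))" for h :: "complex \<Rightarrow> complex"
    unfolding X_def using fin disj
    by (subst prod.union_disjoint) (auto simp: prod.reindex[OF inj] prod.reindex[OF injr])
  have sumX: "(\<Sum>x\<in>X. h x) = (\<Sum>k\<in>K. h (\<omega> k)) + (\<Sum>k\<in>K. h (reflect (\<omega> k)))" for h :: "complex \<Rightarrow> complex"
    unfolding X_def using fin disj
    by (subst sum.union_disjoint) (auto simp: sum.reindex[OF inj] sum.reindex[OF injr])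
  define P\<omega> where "P\<omega> L = (\<Prod>k\<in>L. - cnj (\<omega> k))" for L
  define P\<zeta> where "P\<zeta> = (\<Prod>j\<in>J. - cnj (\<zeta> j))"
  have nz: "P\<omega> L \<noteq> 0" if "L \<subseteq> K" for L
    using that \<omega>0 fin by (auto simp: P\<omega>_def prod_zero_iff finite_subset)
  have c: "c = q / \<beta> * P\<zeta> / P\<omega> K" by (simp add: c_def P\<omega>_def P\<zeta>_def)
  have powK: "w ^ card K = w ^ d * w ^ card J" for w :: complex
    using card by (simp add: d_def power_add[symmetric])
  have res1: "poly N (\<omega> k) / (\<Prod>y\<in>X - {\<omega> k}. \<omega> k - y) = A k" if k: "k \<in> K" for k
  proof -
    have "(\<Prod>y\<in>X - {\<omega> k}. \<omega> k - y) = (\<Prod>y\<in>\<omega> ` (K - {k}) \<union> (\<lambda>k. reflect (\<omega> k)) ` K. \<omega> k - y)"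
      using disj k inj by (intro prod.cong) (auto simp: X_def inj_on_def)
    also have "\<dots> = (\<Prod>j\<in>K - {k}. \<omega> k - \<omega> j) * (\<Prod>j\<in>K. \<omega> k - reflect (\<omega> j))"
      using fin disj by (subst prod.union_disjoint)
        (auto simp: prod.reindex[OF inj_on_subset[OF inj]] prod.reindex[OF injr])
    finally have den: "(\<Prod>y\<in>X - {\<omega> k}. \<omega> k - y) = (\<Prod>j\<in>K - {k}. \<omega> k - \<omega> j) * (\<Prod>j\<in>K. \<omega> k - reflect (\<omega> j))" .
    have 1: "(\<Prod>j\<in>J. cnj (reflect (\<omega> k) - \<zeta> j)) = P\<zeta> * (\<Prod>j\<in>J. \<omega> k - reflect (\<zeta> j)) / \<omega> k ^ card J"
      unfolding P\<zeta>_def by (rule prod_cnj_reflect_diff) (use \<omega>0[OF k] \<zeta>0 in auto)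
    have 2: "(\<Prod>j\<in>K. cnj (reflect (\<omega> k) - \<omega> j)) = P\<omega> K * (\<Prod>j\<in>K. \<omega> k - reflect (\<omega> j)) / \<omega> k ^ card K"
      unfolding P\<omega>_def by (rule prod_cnj_reflect_diff) (use \<omega>0[OF k] \<omega>0 in auto)
    show ?thesis
      unfolding A_def polyN den 1 2 c powK using \<omega>0[OF k] by (simp add: divide_simps)
  qed
  \<comment> \<open>The factor \<open>- (reflect (\<omega> k))\<^sup>2\<close> is what a residue
    acquires under the change of variable 1/z. Here it is found directly: conjugating
    \<open>A k\<close> turns its factors into differences from \<open>w\<close>, one factor
    \<open>w\<close> stems from splitting \<open>\<omega> k\<close> off \<open>P\<omega> K\<close>
    and one from the powers of \<open>w\<close>.\<close>
  have res2: "poly N (reflect (\<omega> k)) / (\<Prod>y\<in>X - {reflect (\<omega> k)}. reflect (\<omega> k) - y) =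
      - cnj (A k) * (reflect (\<omega> k))\<^sup>2" if k: "k \<in> K" for k
  proof -
    define w where "w = reflect (\<omega> k)"
    have w0: "w \<noteq> 0" using refl0[OF k] by (simp add: w_def)
    have \<omega>w: "\<omega> k = reflect w" by (simp add: w_def)
    have "(\<Prod>y\<in>X - {w}. w - y) = (\<Prod>y\<in>\<omega> ` K \<union> (\<lambda>k. reflect (\<omega> k)) ` (K - {k}). w - y)"
      using disj k injr by (intro prod.cong) (auto simp: X_def inj_on_def w_def)
    also have "\<dots> = (\<Prod>j\<in>K. w - \<omega> j) * (\<Prod>j\<in>K - {k}. w - reflect (\<omega> j))"
      using fin disj by (subst prod.union_disjoint)
        (auto simp: prod.reindex[OF inj_on_subset[OF injr]] prod.reindex[OF inj])
    finally have den: "(\<Prod>y\<in>X - {w}. w - y) = (\<Prod>j\<in>K. w - \<omega> j) * (\<Prod>j\<in>K - {k}. w - reflect (\<omega> j))" .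
    have 1: "(\<Prod>j\<in>J. cnj (\<omega> k - \<zeta> j)) = P\<zeta> * (\<Prod>j\<in>J. w - reflect (\<zeta> j)) / w ^ card J"
      unfolding P\<zeta>_def \<omega>w by (rule prod_cnj_reflect_diff) (use w0 \<zeta>0 in auto)
    have 2: "(\<Prod>j\<in>K - {k}. cnj (\<omega> k - \<omega> j)) =
        P\<omega> (K - {k}) * (\<Prod>j\<in>K - {k}. w - reflect (\<omega> j)) / w ^ card (K - {k})"
      unfolding P\<omega>_def \<omega>w by (rule prod_cnj_reflect_diff) (use w0 \<omega>0 in auto)
    have 3: "P\<omega> K = (- 1 / w) * P\<omega> (K - {k})"
      using fin k w0 by (simp add: P\<omega>_def prod.remove[of K k] w_def reflect_def)
    have 4: "w ^ d * w ^ card J = w * w ^ card (K - {k})"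
      using powK[of w] fin k by (metis card_Suc_Diff1 power_Suc)
    have "cnj (A k) = q / \<beta> *
      (((\<Prod>j\<in>J. cnj (\<omega> k - \<zeta> j)) * (\<Prod>j\<in>J. w - \<zeta> j)) /
       ((\<Prod>j\<in>K - {k}. cnj (\<omega> k - \<omega> j)) * (\<Prod>j\<in>K. w - \<omega> j)))"
      by (simp add: A_def w_def q)
    also have "\<dots> = q / \<beta> * P\<zeta> / P\<omega> (K - {k}) * (w ^ card (K - {k}) / w ^ card J) *
      ((\<Prod>j\<in>J. w - reflect (\<zeta> j)) * (\<Prod>j\<in>J. w - \<zeta> j)) /
       ((\<Prod>j\<in>K - {k}. w - reflect (\<omega> j)) * (\<Prod>j\<in>K. w - \<omega> j))"
      unfolding 1 2 using w0 by (simp add: divide_simps)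
    also have "w ^ card (K - {k}) / w ^ card J = w ^ d / w"
      using 4 w0 by (simp add: field_simps)
    finally have "- cnj (A k) * w\<^sup>2 = - (q / \<beta> * P\<zeta> / P\<omega> (K - {k}) * (w ^ d / w) *
      ((\<Prod>j\<in>J. w - reflect (\<zeta> j)) * (\<Prod>j\<in>J. w - \<zeta> j)) /
       ((\<Prod>j\<in>K - {k}. w - reflect (\<omega> j)) * (\<Prod>j\<in>K. w - \<omega> j))) * w\<^sup>2" by simp
    also have "\<dots> = poly N w / (\<Prod>y\<in>X - {w}. w - y)"
      unfolding polyN den c 3 using w0 nz[of "K - {k}"] by (simp add: divide_simps power2_eq_square)
    finally show ?thesis by (simp add: w_def)
  qed
  have "poly N z / (\<Prod>x\<in>X. z - x) =
      coeff N (card X) + (\<Sum>x\<in>X. poly N x / (\<Prod>y\<in>X - {x}. x - y) / (z - x))"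
    by (rule partial_fractions[OF finX degN zX])
  also have "(\<Sum>x\<in>X. poly N x / (\<Prod>y\<in>X - {x}. x - y) / (z - x)) =
      (\<Sum>k\<in>K. A k / (z - \<omega> k)) + (\<Sum>k\<in>K. - cnj (A k) * (reflect (\<omega> k))\<^sup>2 / (z - reflect (\<omega> k)))"
    unfolding sumX by (simp only: res1 res2 cong: sum.cong)
  finally show ?thesis
    by (simp add: prodX coeffN polyN d_def sum_negf)
qed

lemma prod_uminus_reflect:
  assumes "\<And>i. i \<in> L \<Longrightarrow> r i \<noteq> 0"
  shows "(\<Prod>i\<in>L. - reflect (r i)) = 1 / (\<Prod>i\<in>L. - cnj (r i))"
proof -
  have "(\<Prod>i\<in>L. - cnj (r i)) * (\<Prod>i\<in>L. - reflect (r i)) = 1"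
    unfolding prod.distrib[symmetric] using assms by (intro prod.neutral) (auto simp: reflect_def)
  then show ?thesis by (metis mult.commute mult_zero_right nonzero_eq_divide_eq zero_neq_one)
qed

lemma reflect_on_circle: "cmod z = 1 \<Longrightarrow> reflect z = z"
  using complex_norm_square[of z] by (cases "z = 0") (simp_all add: reflect_def field_simps)

lemma prod_cmod_squared_on_circle:
  assumes z: "cmod z = 1" and r: "\<And>i. i \<in> L \<Longrightarrow> r i \<noteq> 0"
  shows "(\<Prod>i\<in>L. complex_of_real ((cmod (z - r i))\<^sup>2)) =
      (\<Prod>i\<in>L. z - r i) * (\<Prod>i\<in>L. - cnj (r i)) * (\<Prod>i\<in>L. z - reflect (r i)) / z ^ card L"
proof -
  have z0: "z \<noteq> 0" using z by auto
  have "complex_of_real ((cmod (z - r i))\<^sup>2) = (z - r i) * (- cnj (r i) * (z - reflect (r i)) / z)" if "i \<in> L" for i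
    using cnj_reflect_diff[OF z0 r[OF that]] by (simp only: reflect_on_circle[OF z] complex_norm_square)
  then have "(\<Prod>i\<in>L. complex_of_real ((cmod (z - r i))\<^sup>2)) = (\<Prod>i\<in>L. (z - r i) * (- cnj (r i) * (z - reflect (r i)) / z))"
    by (rule prod.cong[OF refl])
  then show ?thesis
    by (simp only: prod_dividef prod.distrib prod_constant times_divide_eq_right mult.assoc)
qed

text \<open>The first claim is that the candidate for \<open>p\<close> is real at 0, where it equals
  \<open>c - S\<close>; it results from evaluating the partial fractions at 0. The second one
  rewrites the inner pole parts on the circle as conjugates of the outer ones.\<close>

lemma field_quotient_on_circle:
  fixes \<omega> :: "'i \<Rightarrow> complex" and \<zeta> :: "'j \<Rightarrow> complex" and q \<beta> :: complex and K :: "'i set" and J :: "'j set"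
  defines "A \<equiv> \<lambda>k. q / \<beta> *
     (((\<Prod>j\<in>J. \<omega> k - \<zeta> j) * (\<Prod>j\<in>J. cnj (reflect (\<omega> k) - \<zeta> j))) /
      ((\<Prod>j\<in>K - {k}. \<omega> k - \<omega> j) * (\<Prod>j\<in>K. cnj (reflect (\<omega> k) - \<omega> j))))"
    and "c \<equiv> if card K = card J then q / \<beta> * (\<Prod>j\<in>J. - cnj (\<zeta> j)) / (\<Prod>k\<in>K. - cnj (\<omega> k)) else 0"
  assumes fin: "finite K" "finite J" and card: "card J \<le> card K" and inj: "inj_on \<omega> K"
    and \<omega>: "\<And>k. k \<in> K \<Longrightarrow> cmod (\<omega> k) > 1" and \<zeta>: "\<And>j. j \<in> J \<Longrightarrow> cmod (\<zeta> j) > 1"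
    and q: "cnj q = q" "cnj \<beta> = \<beta>"
  shows "Im (c - (\<Sum>k\<in>K. A k / \<omega> k)) = 0"
    and "cmod z = 1 \<Longrightarrow> Re (c + (\<Sum>k\<in>K. A k / \<omega> k) + (\<Sum>k\<in>K. 2 * A k / (z - \<omega> k))) =
      Re (q / \<beta> * ((\<Prod>j\<in>J. (cmod (z - \<zeta> j))\<^sup>2) / (\<Prod>k\<in>K. (cmod (z - \<omega> k))\<^sup>2)))"
proof -
  define c1 where "c1 = q / \<beta> * (\<Prod>j\<in>J. - cnj (\<zeta> j)) / (\<Prod>k\<in>K. - cnj (\<omega> k))"
  have pf: "c1 * (z ^ (card K - card J) * (\<Prod>j\<in>J. z - \<zeta> j) * (\<Prod>j\<in>J. z - reflect (\<zeta> j))) /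
      ((\<Prod>k\<in>K. z - \<omega> k) * (\<Prod>k\<in>K. z - reflect (\<omega> k))) =
    (if card K = card J then c1 else 0)
     + (\<Sum>k\<in>K. A k / (z - \<omega> k)) - (\<Sum>k\<in>K. cnj (A k) * (reflect (\<omega> k))\<^sup>2 / (z - reflect (\<omega> k)))"
    if "cmod z \<le> 1" "\<And>k. k \<in> K \<Longrightarrow> z \<noteq> reflect (\<omega> k)" for z
    unfolding A_def c1_def by (rule partial_fractions_symmetric) (use fin card inj \<omega> \<zeta> q that in auto)
  have \<omega>0: "\<omega> k \<noteq> 0" if "k \<in> K" for k using \<omega>[OF that] by auto
  have \<zeta>0: "\<zeta> j \<noteq> 0" if "j \<in> J" for j using \<zeta>[OF that] by auto
  have refl1: "cmod (reflect (\<omega> k)) < 1" if "k \<in> K" for k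
    using \<omega>[OF that] by (simp add: reflect_def norm_divide divide_simps)
  have refl0: "reflect (\<omega> k) \<noteq> 0" if "k \<in> K" for k using \<omega>0[OF that] by (simp add: reflect_def)
  have cc: "c = (if card K = card J then c1 else 0)" by (simp add: c_def c1_def)
  define S where "S = (\<Sum>k\<in>K. A k / \<omega> k)"
  have cS: "cnj S = (\<Sum>k\<in>K. cnj (A k) * reflect (\<omega> k))"
    by (simp add: S_def reflect_def)
  show "Im (c - (\<Sum>k\<in>K. A k / \<omega> k)) = 0"
  proof -
    have nz: "(\<Prod>j\<in>J. - cnj (\<zeta> j)) \<noteq> 0" "(\<Prod>k\<in>K. - cnj (\<omega> k)) \<noteq> 0"
      using \<zeta>0 \<omega>0 fin by (auto simp: prod_zero_iff)
    \<comment> \<open>By the reflection symmetry the value at 0 is the conjugate of the value at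
      infinity; if there are more zeros than poles, both are 0.\<close>
    have R0: "c1 * (0 ^ (card K - card J) * (\<Prod>j\<in>J. 0 - \<zeta> j) * (\<Prod>j\<in>J. 0 - reflect (\<zeta> j))) /
      ((\<Prod>k\<in>K. 0 - \<omega> k) * (\<Prod>k\<in>K. 0 - reflect (\<omega> k))) = cnj c"
    proof (cases "card K = card J")
      case True
      have "(\<Prod>j\<in>J. - reflect (\<zeta> j)) = 1 / (\<Prod>j\<in>J. - cnj (\<zeta> j))"
        "(\<Prod>k\<in>K. - reflect (\<omega> k)) = 1 / (\<Prod>k\<in>K. - cnj (\<omega> k))"
        using \<zeta>0 \<omega>0 by (simp_all add: prod_uminus_reflect)
      then have "c1 * (0 ^ (card K - card J) * (\<Prod>j\<in>J. 0 - \<zeta> j) * (\<Prod>j\<in>J. 0 - reflect (\<zeta> j))) /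
         ((\<Prod>k\<in>K. 0 - \<omega> k) * (\<Prod>k\<in>K. 0 - reflect (\<omega> k))) =
         q / \<beta> * (\<Prod>j\<in>J. - cnj (\<zeta> j)) / (\<Prod>k\<in>K. - cnj (\<omega> k)) *
         ((\<Prod>j\<in>J. - \<zeta> j) * (1 / (\<Prod>j\<in>J. - cnj (\<zeta> j)))) /
         ((\<Prod>k\<in>K. - \<omega> k) * (1 / (\<Prod>k\<in>K. - cnj (\<omega> k))))"
        using True by (simp only: c1_def diff_0 diff_self_eq_0 power_0 mult_1_left)
      also have "\<dots> = q / \<beta> * (\<Prod>j\<in>J. - \<zeta> j) / (\<Prod>k\<in>K. - \<omega> k)"
      proof -
        have "x / y * u / v * (r * (1 / u)) / (s * (1 / v)) = x / y * r / s"
          if "u \<noteq> 0" "v \<noteq> 0" for x y u v r s :: complex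
          using that by (simp add: divide_simps)
        then show ?thesis using nz by blast
      qed
      also have "\<dots> = cnj c" using True by (simp add: c_def q)
      finally show ?thesis .
    next
      case False
      then have "card K - card J \<noteq> 0" using card by simp
      then show ?thesis using False by (simp add: c_def zero_power)
    qed
    have s1: "(\<Sum>k\<in>K. A k / (0 - \<omega> k)) = - S" by (simp add: S_def sum_negf)
    have s2: "(\<Sum>k\<in>K. cnj (A k) * (reflect (\<omega> k))\<^sup>2 / (0 - reflect (\<omega> k))) = - cnj S"
      unfolding cS sum_negf[symmetric] using refl0 by (intro sum.cong) (auto simp: power2_eq_square)
    have "0 \<noteq> reflect (\<omega> k)" if "k \<in> K" for k using refl0[OF that] by metis
    then have "cnj c = c + - S - - cnj S"
      unfolding R0[symmetric] s1[symmetric] s2[symmetric] unfolding cc by (intro pf) auto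
    then have "cnj c = c - S + cnj S" by simp
    then have "Im (cnj c) = Im (c - S + cnj S)" by (rule arg_cong)
    then show ?thesis unfolding S_def[symmetric] by simp
  qed
  assume z: "cmod z = 1"
  have z0: "z \<noteq> 0" using z by auto
  have rz: "reflect z = z" using z by (rule reflect_on_circle)
  have psq: "(\<Prod>j\<in>J. complex_of_real ((cmod (z - \<zeta> j))\<^sup>2)) =
      (\<Prod>j\<in>J. z - \<zeta> j) * (\<Prod>j\<in>J. - cnj (\<zeta> j)) * (\<Prod>j\<in>J. z - reflect (\<zeta> j)) / z ^ card J"
    "(\<Prod>k\<in>K. complex_of_real ((cmod (z - \<omega> k))\<^sup>2)) =
      (\<Prod>k\<in>K. z - \<omega> k) * (\<Prod>k\<in>K. - cnj (\<omega> k)) * (\<Prod>k\<in>K. z - reflect (\<omega> k)) / z ^ card K"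
    by (rule prod_cmod_squared_on_circle[OF z], erule \<zeta>0) (rule prod_cmod_squared_on_circle[OF z], erule \<omega>0)
  have ne: "z - \<omega> k \<noteq> 0" "z - reflect (\<omega> k) \<noteq> 0" if "k \<in> K" for k
    using \<omega>[OF that] refl1[OF that] z by auto
  have pne: "(\<Prod>k\<in>K. z - \<omega> k) \<noteq> 0" "(\<Prod>k\<in>K. z - reflect (\<omega> k)) \<noteq> 0" "(\<Prod>k\<in>K. - cnj (\<omega> k)) \<noteq> 0"
    using ne \<omega>0 fin by (auto simp: prod_zero_iff)
  have "q / \<beta> * ((\<Prod>j\<in>J. (cmod (z - \<zeta> j))\<^sup>2) / (\<Prod>k\<in>K. (cmod (z - \<omega> k))\<^sup>2)) =
      q / \<beta> * (((\<Prod>j\<in>J. z - \<zeta> j) * (\<Prod>j\<in>J. - cnj (\<zeta> j)) * (\<Prod>j\<in>J. z - reflect (\<zeta> j)) / z ^ card J) /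
       ((\<Prod>k\<in>K. z - \<omega> k) * (\<Prod>k\<in>K. - cnj (\<omega> k)) * (\<Prod>k\<in>K. z - reflect (\<omega> k)) / z ^ card K))"
    by (simp only: of_real_divide of_real_prod psq)
  also have "\<dots> = c1 * (z ^ (card K - card J) * (\<Prod>j\<in>J. z - \<zeta> j) * (\<Prod>j\<in>J. z - reflect (\<zeta> j))) /
      ((\<Prod>k\<in>K. z - \<omega> k) * (\<Prod>k\<in>K. z - reflect (\<omega> k)))"
  proof -
    have "z ^ card K = z ^ (card K - card J) * z ^ card J" using card by (simp add: power_add[symmetric])
    then show ?thesis unfolding c1_def using pne z0 by (simp add: divide_simps)
  qed
  also have "\<dots> = c + (\<Sum>k\<in>K. A k / (z - \<omega> k)) - (\<Sum>k\<in>K. cnj (A k) * (reflect (\<omega> k))\<^sup>2 / (z - reflect (\<omega> k)))"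
    unfolding cc using z ne by (intro pf) auto
  \<comment> \<open>On the circle the conjugate of the outer pole part is again rational in
    \<open>z\<close>, with poles at the reflected zeros and the value \<open>- cnj S\<close> at
    infinity; adding \<open>cnj S\<close> leaves only pole parts.\<close>
  also have "(\<Sum>k\<in>K. cnj (A k) * (reflect (\<omega> k))\<^sup>2 / (z - reflect (\<omega> k))) =
      - (cnj (\<Sum>k\<in>K. A k / (z - \<omega> k)) + cnj S)"
    unfolding cS cnj_sum sum.distrib[symmetric] sum_negf[symmetric]
  proof (rule sum.cong[OF refl])
    fix k assume k: "k \<in> K"
    define w where "w = reflect (\<omega> k)"
    have w0: "w \<noteq> 0" "z - w \<noteq> 0" using refl0[OF k] ne[OF k] by (simp_all add: w_def)
    have "cnj (z - \<omega> k) = - cnj (\<omega> k) * (z - w) / z"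
      using cnj_reflect_diff[OF z0 \<omega>0[OF k]] by (simp add: rz w_def)
    also have "\<dots> = - (z - w) / (w * z)"
      using \<omega>0[OF k] z0 by (simp add: w_def reflect_def divide_simps)
    finally have "cnj (A k / (z - \<omega> k)) = cnj (A k) / (- (z - w) / (w * z))" by simp
    also have "\<dots> + cnj (A k) * w = - (cnj (A k) * w\<^sup>2 / (z - w))"
      using w0 z0 by (simp add: divide_simps power2_eq_square) (simp add: algebra_simps)
    finally show "cnj (A k) * (reflect (\<omega> k))\<^sup>2 / (z - reflect (\<omega> k)) =
        - (cnj (A k / (z - \<omega> k)) + cnj (A k) * reflect (\<omega> k))"
      by (simp add: w_def)
  qed
  finally have "q / \<beta> * ((\<Prod>j\<in>J. (cmod (z - \<zeta> j))\<^sup>2) / (\<Prod>k\<in>K. (cmod (z - \<omega> k))\<^sup>2)) =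
     c + (\<Sum>k\<in>K. A k / (z - \<omega> k)) + (cnj (\<Sum>k\<in>K. A k / (z - \<omega> k)) + cnj S)" by simp
  note main = this
  define T where "T = (\<Sum>k\<in>K. A k / (z - \<omega> k))"
  have "Re (q / \<beta> * ((\<Prod>j\<in>J. (cmod (z - \<zeta> j))\<^sup>2) / (\<Prod>k\<in>K. (cmod (z - \<omega> k))\<^sup>2))) = Re (c + T + (cnj T + cnj S))"
    unfolding main T_def ..
  also have "\<dots> = Re (c + S + 2 * T)" by simp
  finally show "Re (c + (\<Sum>k\<in>K. A k / \<omega> k) + (\<Sum>k\<in>K. 2 * A k / (z - \<omega> k))) =
      Re (q / \<beta> * ((\<Prod>j\<in>J. (cmod (z - \<zeta> j))\<^sup>2) / (\<Prod>k\<in>K. (cmod (z - \<omega> k))\<^sup>2)))"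
    by (simp add: S_def T_def sum_distrib_left)
qed

section \<open>Motion of the zeros and poles\<close>

text \<open>A continuous logarithm \<open>L\<close> exists since \<open>I\<close> is contractible.
  Near \<open>t\<close> it is \<open>L t + Ln (\<phi> s / \<phi> t)\<close>: the quotient is close
  to 1, away from the branch cut, and \<open>L s - L t\<close> stays in the strip where
  \<open>Ln\<close> inverts \<open>exp\<close>.\<close>

lemma has_log_deriv_if_has_vector_derivative:
  assumes I: "is_interval I"
    and der: "\<And>t. t \<in> I \<Longrightarrow> (\<phi> has_vector_derivative \<phi> t * D t) (at t within I)"
    and nz: "\<And>t. t \<in> I \<Longrightarrow> \<phi> t \<noteq> 0"
  shows "has_log_deriv I \<phi> D"
proof -
  have "continuous_on I \<phi>"
    unfolding continuous_on_eq_continuous_within by (intro ballI has_vector_derivative_continuous[OF der])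
  moreover have "contractible I"
    using I by (intro convex_imp_contractible) (simp add: is_interval_convex)
  ultimately obtain L where L: "continuous_on I L" "\<And>t. t \<in> I \<Longrightarrow> \<phi> t = exp (L t)"
    using continuous_logarithm_on_contractible[of I \<phi>] nz by metis
  have "(L has_vector_derivative D t) (at t within I)" if t: "t \<in> I" for t
  proof -
    have "((\<lambda>s. \<phi> s / \<phi> t) has_vector_derivative \<phi> t * D t / \<phi> t) (at t within I)"
      using has_vector_derivative_mult_left[OF der[OF t], of "1 / \<phi> t"] by simp
    then have quot: "((\<lambda>s. \<phi> s / \<phi> t) has_vector_derivative D t) (at t within I)"
      using nz[OF t] by simp
    have "(Ln has_field_derivative 1) (at (\<phi> t / \<phi> t) within (\<lambda>s. \<phi> s / \<phi> t) ` I)"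
      using nz[OF t] has_field_derivative_Ln[of 1] by (simp add: has_field_derivative_at_within)
    from field_vector_diff_chain_within[OF quot this]
    have "((\<lambda>s. Ln (\<phi> s / \<phi> t)) has_vector_derivative D t) (at t within I)" by (simp add: o_def)
    then have lnd: "((\<lambda>s. L t + Ln (\<phi> s / \<phi> t)) has_vector_derivative D t) (at t within I)"
      by (auto intro!: derivative_eq_intros)
    obtain d where d: "d > 0" "\<And>s. s \<in> I \<Longrightarrow> dist s t < d \<Longrightarrow> dist (L s) (L t) < pi"
      using L(1) t pi_gt_zero unfolding continuous_on_iff by metis
    show ?thesis
    proof (rule has_vector_derivative_transform_within[OF lnd d(1) t])
      fix s assume s: "s \<in> I" "dist s t < d"
      have "\<bar>Im (L s - L t)\<bar> < pi"
        using d(2)[OF s] abs_Im_le_cmod[of "L s - L t"] by (simp add: dist_norm)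
      then have "Ln (exp (L s - L t)) = L s - L t" by (intro Ln_exp) auto
      then show "L t + Ln (\<phi> s / \<phi> t) = L s" using L(2) s t by (simp add: exp_diff)
    qed
  qed
  then show ?thesis unfolding has_log_deriv_def using L(2) by (intro exI[of _ L]) auto
qed

section \<open>Moving zeros and poles of a rational function\<close>

lemma poly_root_poly_var_eq:
  assumes "finite K" "\<And>k. k \<in> K \<Longrightarrow> x \<noteq> r k"
  shows "poly (root_poly_var K r v) x = - ((\<Prod>k\<in>K. x - r k) * (\<Sum>k\<in>K. v k / (x - r k)))"
proof -
  have "v j * (\<Prod>i\<in>K - {j}. x - r i) = (\<Prod>k\<in>K. x - r k) * (v j / (x - r j))" if "j \<in> K" for j
    using assms that by (simp add: prod.remove)
  then show ?thesis by (simp add: poly_root_poly_var sum_distrib_left)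
qed

lemma poly_root_poly_var_root:
  assumes "finite K" "k \<in> K"
  shows "poly (root_poly_var K r v) (r k) = - (v k * (\<Prod>i\<in>K - {k}. r k - r i))"
proof -
  have "(\<Sum>j\<in>K. v j * (\<Prod>i\<in>K - {j}. r k - r i)) =
      (\<Sum>j\<in>K. if j = k then v k * (\<Prod>i\<in>K - {k}. r k - r i) else 0)"
    using assms by (intro sum.cong) (auto simp: prod_zero_iff)
  then show ?thesis using assms by (simp add: poly_root_poly_var)
qed

lemma prod_has_vector_derivative:
  assumes "\<And>k. k \<in> K \<Longrightarrow> (r k has_vector_derivative v k) (at t within I)"
  shows "((\<lambda>s. \<Prod>k\<in>K. x - r k s) has_vector_derivative poly (root_poly_var K (\<lambda>k. r k t) v) x) (at t within I)"
proof -
  have "((\<lambda>s. x - r k s) has_derivative (\<lambda>y. y *\<^sub>R (- v k))) (at t within I)" if "k \<in> K" for k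
    using has_vector_derivative_diff[OF has_vector_derivative_const assms[OF that], of x]
    by (simp add: has_vector_derivative_def)
  from has_derivative_prod[of K "\<lambda>k s. x - r k s", OF this]
  have "((\<lambda>s. \<Prod>k\<in>K. x - r k s) has_derivative
      (\<lambda>y. \<Sum>i\<in>K. y *\<^sub>R (- v i) * (\<Prod>j\<in>K - {i}. x - r j t))) (at t within I)" by simp
  moreover have "(\<lambda>y. \<Sum>i\<in>K. y *\<^sub>R (- v i) * (\<Prod>j\<in>K - {i}. x - r j t)) =
      (\<lambda>y. y *\<^sub>R poly (root_poly_var K (\<lambda>k. r k t) v) x)"
    by (simp add: poly_root_poly_var scaleR_sum_right sum_negf fun_eq_iff)
  ultimately show ?thesis by (simp add: has_vector_derivative_def)
qed

lemma coeff_mult_top: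
  assumes "degree p \<le> m" "degree q \<le> n"
  shows "coeff (p * q) (m + n) = coeff p m * coeff q n"
proof -
  have "coeff (p * q) (m + n) = (\<Sum>i\<le>m + n. if i = m then coeff p m * coeff q n else 0)"
    unfolding coeff_mult
  proof (rule sum.cong[OF refl])
    fix i assume "i \<in> {..m + n}"
    show "coeff p i * coeff q (m + n - i) = (if i = m then coeff p m * coeff q n else 0)"
    proof (cases i m rule: linorder_cases)
      case less
      then have "coeff q (m + n - i) = 0" using assms by (intro coeff_eq_0) auto
      then show ?thesis using less by simp
    next
      case greater
      then have "coeff p i = 0" using assms by (intro coeff_eq_0) auto
      then show ?thesis using greater by simp
    qed simp
  qed
  then show ?thesis by simp
qed

text \<open>
  Multiplying by the denominators at the two times \<open>s\<close> and \<open>t\<close> turns the increment of \<open>G\<close> into a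
  polynomial in \<open>x\<close>. Its coefficients are differentiable because its values on \<open>X\<close> are; the leading
  one yields \<open>b\<close>, and the value at a zero of \<open>G\<close> at time \<open>t\<close> yields the motion of that zero.
\<close>

lemma rational_motion:
  fixes b :: "real \<Rightarrow> complex" and \<omega> :: "'i \<Rightarrow> real \<Rightarrow> complex" and \<zeta> :: "'j \<Rightarrow> real \<Rightarrow> complex"
    and G :: "complex \<Rightarrow> real \<Rightarrow> complex"
  assumes fin: "finite K" "finite J" and t: "t \<in> I" and X: "infinite X"
    and G: "\<And>x s. x \<in> X \<Longrightarrow> s \<in> I \<Longrightarrow> G x s = b s * ((\<Prod>k\<in>K. x - \<omega> k s) / (\<Prod>j\<in>J. x - \<zeta> j s))"
    and X\<omega>: "\<And>x k. x \<in> X \<Longrightarrow> k \<in> K \<Longrightarrow> x \<noteq> \<omega> k t"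
    and X\<zeta>: "\<And>x j s. x \<in> X \<Longrightarrow> j \<in> J \<Longrightarrow> s \<in> I \<Longrightarrow> x \<noteq> \<zeta> j s"
    and cont\<omega>: "\<And>k. k \<in> K \<Longrightarrow> continuous (at t within I) (\<omega> k)"
    and cont\<zeta>: "\<And>j. j \<in> J \<Longrightarrow> continuous (at t within I) (\<zeta> j)"
    and b: "b t \<noteq> 0" and inj: "inj_on (\<lambda>k. \<omega> k t) K"
    and nc: "\<And>k j. k \<in> K \<Longrightarrow> j \<in> J \<Longrightarrow> \<omega> k t \<noteq> \<zeta> j t"
    and der: "\<And>x. x \<in> X \<Longrightarrow> (G x has_vector_derivative
        G x t * (B - (\<Sum>k\<in>K. W k / (x - \<omega> k t)) + (\<Sum>j\<in>J. V j / (x - \<zeta> j t)))) (at t within I)"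
  shows "(b has_vector_derivative b t * B) (at t within I)"
    and "\<And>k. k \<in> K \<Longrightarrow> (\<omega> k has_vector_derivative W k) (at t within I)"
    and "\<And>x. x \<in> X \<Longrightarrow> ((\<lambda>s. \<Prod>j\<in>J. x - \<zeta> j s) has_vector_derivative
        poly (root_poly_var J (\<lambda>j. \<zeta> j t) V) x) (at t within I)"
proof -
  define P where "P s = root_poly K (\<lambda>k. \<omega> k s)" for s
  define Q where "Q s = root_poly J (\<lambda>j. \<zeta> j s)" for s
  define P' where "P' = root_poly_var K (\<lambda>k. \<omega> k t) W"
  define Q' where "Q' = root_poly_var J (\<lambda>j. \<zeta> j t) V"
  define p where "p s = smult (b s) (P s * Q t) - smult (b t) (P t * Q s)" for s
  define p' where "p' = smult (b t) (smult B (P t * Q t) + P' * Q t - P t * Q')"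
  define N where "N = card K + card J"
  have deg: "degree (P s) \<le> card K" "degree (Q s) \<le> card J" "degree P' \<le> card K" "degree Q' \<le> card J" for s
    by (simp_all add: P_def Q_def P'_def Q'_def degree_root_poly_var)
  have degm: "degree (u * v) \<le> N" if "degree u \<le> card K" "degree v \<le> card J" for u v :: "complex poly"
    using degree_mult_le[of u v] that by (simp add: N_def)
  have degp: "degree (p s) \<le> N" for s
    unfolding p_def by (intro degree_diff_le order_trans[OF degree_smult_le] degm deg)
  have degp': "degree p' \<le> N"
    unfolding p'_def by (intro degree_diff_le degree_add_le order_trans[OF degree_smult_le] degm deg)
  have Qnz: "poly (Q s) x \<noteq> 0" if "x \<in> X" "s \<in> I" for x s
    using X\<zeta> that fin by (simp add: Q_def prod_zero_iff)
  have Pnz: "poly (P t) x \<noteq> 0" if "x \<in> X" for x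
    using X\<omega> that fin by (simp add: P_def prod_zero_iff)
  have GPQ: "G x s = b s * (poly (P s) x / poly (Q s) x)" if "x \<in> X" "s \<in> I" for x s
    using G[OF that] by (simp add: P_def Q_def)
  have P'x: "poly P' x = - (poly (P t) x * (\<Sum>k\<in>K. W k / (x - \<omega> k t)))" if "x \<in> X" for x
    unfolding P'_def P_def poly_root_poly by (rule poly_root_poly_var_eq) (use fin X\<omega> that in auto)
  have Q'x: "poly Q' x = - (poly (Q t) x * (\<Sum>j\<in>J. V j / (x - \<zeta> j t)))" if "x \<in> X" for x
    unfolding Q'_def Q_def poly_root_poly by (rule poly_root_poly_var_eq) (use fin X\<zeta> that t in auto)
  have contQ: "continuous (at t within I) (\<lambda>s. poly (Q s) x)" for x
    unfolding Q_def poly_root_poly by (intro continuous_intros cont\<zeta>)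
  have vanish: "((\<lambda>s. G x s - G x t) has_vector_derivative
      G x t * (B - (\<Sum>k\<in>K. W k / (x - \<omega> k t)) + (\<Sum>j\<in>J. V j / (x - \<zeta> j t)))) (at t within I)" if "x \<in> X" for x
    using has_vector_derivative_diff[OF der[OF that] has_vector_derivative_const] by simp
  \<comment> \<open>On \<open>X\<close> the polynomial \<open>p s\<close> is the increment of
    \<open>G\<close> times \<open>Q s\<close> and \<open>Q t\<close>. The increment vanishes at
    \<open>t\<close>, so \<open>Q s\<close> enters only through its continuity.\<close>
  have pder: "((\<lambda>s. poly (p s) x) has_vector_derivative poly p' x) (at t within I)" if x: "x \<in> X" for x
  proof -
    have "((\<lambda>s. (G x s - G x t) * (poly (Q s) x * poly (Q t) x)) has_vector_derivative
        G x t * (B - (\<Sum>k\<in>K. W k / (x - \<omega> k t)) + (\<Sum>j\<in>J. V j / (x - \<zeta> j t))) * (poly (Q t) x * poly (Q t) x))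
        (at t within I)"
      by (intro has_vector_derivative_mult_vanishing vanish x continuous_intros contQ) simp
    moreover have "G x t * (B - (\<Sum>k\<in>K. W k / (x - \<omega> k t)) + (\<Sum>j\<in>J. V j / (x - \<zeta> j t))) * (poly (Q t) x * poly (Q t) x)
        = poly p' x"
      unfolding p'_def GPQ[OF x t] using Qnz[OF x t]
      by (simp add: P'x[OF x] Q'x[OF x]) (simp add: algebra_simps)
    ultimately have 1: "((\<lambda>s. (G x s - G x t) * (poly (Q s) x * poly (Q t) x)) has_vector_derivative poly p' x)
        (at t within I)" by simp
    show ?thesis
    proof (rule has_vector_derivative_transform[OF t _ 1])
      fix s assume "s \<in> I"
      then show "poly (p s) x = (G x s - G x t) * (poly (Q s) x * poly (Q t) x)"
        using Qnz[OF x] t by (simp add: GPQ[OF x] p_def field_simps)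
    qed
  qed
  note pd = X t degp degp' pder
  \<comment> \<open>\<open>P\<close> and \<open>Q\<close> are monic and their variations have no top
    coefficient, so the top coefficient of \<open>p s\<close> is \<open>b s - b t\<close>.\<close>
  have topPQ: "coeff (P s * Q s') N = 1" for s s'
    unfolding N_def coeff_mult_top[OF deg(1,2)] by (simp add: P_def Q_def)
  have top': "coeff (P' * Q t) N = 0" "coeff (P t * Q') N = 0"
    unfolding N_def coeff_mult_top[OF deg(3,2)] coeff_mult_top[OF deg(1,4)] by (simp_all add: P'_def Q'_def)
  have "((\<lambda>s. coeff (p s) N) has_vector_derivative coeff p' N) (at t within I)"
    by (rule coeff_has_vector_derivative[OF pd])
  then have "((\<lambda>s. b s - b t) has_vector_derivative b t * B) (at t within I)"
    by (simp add: p_def p'_def topPQ top')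
  from has_vector_derivative_add[OF this has_vector_derivative_const[of "b t"]]
  show bd: "(b has_vector_derivative b t * B) (at t within I)" by simp
  show wd: "(\<omega> k has_vector_derivative W k) (at t within I)" if k: "k \<in> K" for k
  proof -
    define w where "w = \<omega> k t"
    \<comment> \<open>Since \<open>P t\<close> vanishes at \<open>w\<close>, the value of
      \<open>p s\<close> there is \<open>(w - \<omega> k s) * E s\<close>. Simple zeros and the
      absence of cancellation make \<open>E t\<close> nonzero, and continuity of \<open>E\<close>
      suffices for dividing by it.\<close>
    define E where "E s = b s * ((\<Prod>i\<in>K - {k}. w - \<omega> i s) * poly (Q t) w)" for s
    have Pw: "poly (P s) w = (w - \<omega> k s) * (\<Prod>i\<in>K - {k}. w - \<omega> i s)" for s
      using fin k by (simp add: P_def prod.remove)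
    have Et: "E t \<noteq> 0"
      using b fin nc[OF k] inj_onD[OF inj _ k] k by (auto simp: E_def Q_def w_def prod_zero_iff)
    have contE: "continuous (at t within I) E"
      unfolding E_def by (intro continuous_intros cont\<omega> has_vector_derivative_continuous[OF bd]) auto
    have "((\<lambda>s. poly (p s) w) has_vector_derivative poly p' w + poly (pderiv (p t)) w * 0) (at t within I)"
      by (rule poly_moving_has_vector_derivative[OF pd has_vector_derivative_const])
    then have "((\<lambda>s. poly (p s) w) has_vector_derivative poly p' w) (at t within I)" by simp
    then have "((\<lambda>s. poly (p s) w * inverse (E s)) has_vector_derivative poly p' w * inverse (E t)) (at t within I)"
      by (rule has_vector_derivative_mult_vanishing) (use contE Et in \<open>auto simp: p_def intro!: continuous_intros\<close>)
    moreover have "poly p' w * inverse (E t) = - W k"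
    proof -
      have "poly P' w = - (W k * (\<Prod>i\<in>K - {k}. w - \<omega> i t))"
        unfolding P'_def w_def using poly_root_poly_var_root[OF fin(1) k, of "\<lambda>k. \<omega> k t"] by simp
      then have "poly p' w = - W k * E t"
        by (simp add: p'_def Pw E_def) (simp add: w_def)
      then show ?thesis using Et by simp
    qed
    ultimately have 1: "((\<lambda>s. poly (p s) w * inverse (E s)) has_vector_derivative - W k) (at t within I)" by simp
    have "\<forall>\<^sub>F s in at t within I. E s \<noteq> 0"
      using contE Et by (intro tendsto_imp_eventually_ne[of E "E t"]) (simp_all add: continuous_within)
    then obtain d where d: "d > 0" "\<And>s. s \<in> I \<Longrightarrow> s \<noteq> t \<Longrightarrow> dist s t < d \<Longrightarrow> E s \<noteq> 0"
      by (auto simp: eventually_at)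
    have "((\<lambda>s. w - \<omega> k s) has_vector_derivative - W k) (at t within I)"
    proof (rule has_vector_derivative_transform_within[OF 1 d(1) t])
      fix s assume s: "s \<in> I" "dist s t < d"
      have "E s \<noteq> 0" using d(2)[OF s(1) _ s(2)] Et by (cases "s = t") auto
      moreover have "poly (p s) w = (w - \<omega> k s) * E s"
        by (simp add: p_def Pw E_def) (simp add: w_def)
      ultimately show "poly (p s) w * inverse (E s) = w - \<omega> k s" by simp
    qed
    from has_vector_derivative_diff[OF has_vector_derivative_const[of w] this] show ?thesis by simp
  qed
  show "((\<lambda>s. \<Prod>j\<in>J. x - \<zeta> j s) has_vector_derivative poly (root_poly_var J (\<lambda>j. \<zeta> j t) V) x) (at t within I)"
    if x: "x \<in> X" for x
  proof -
    have Gt: "G x t \<noteq> 0" using b Pnz[OF x] Qnz[OF x t] by (simp add: GPQ[OF x t])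
    have Pd: "((\<lambda>s. poly (P s) x) has_vector_derivative poly P' x) (at t within I)"
      unfolding P_def P'_def poly_root_poly by (rule prod_has_vector_derivative[OF wd])
    \<comment> \<open>Because \<open>b s * P s = G x s * Q s\<close>, this expression is
      \<open>G x t * Q s\<close>. In this form \<open>Q s\<close> is multiplied only by an increment
      vanishing at \<open>t\<close>, so its differentiability is obtained rather than
      presupposed.\<close>
    have "((\<lambda>s. b s * poly (P s) x - (G x s - G x t) * poly (Q s) x) has_vector_derivative
       (b t * poly P' x + b t * B * poly (P t) x) -
        G x t * (B - (\<Sum>k\<in>K. W k / (x - \<omega> k t)) + (\<Sum>j\<in>J. V j / (x - \<zeta> j t))) * poly (Q t) x) (at t within I)"
      by (intro has_vector_derivative_diff has_vector_derivative_mult bd Pd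
          has_vector_derivative_mult_vanishing vanish x contQ) simp
    also have "(b t * poly P' x + b t * B * poly (P t) x) -
        G x t * (B - (\<Sum>k\<in>K. W k / (x - \<omega> k t)) + (\<Sum>j\<in>J. V j / (x - \<zeta> j t))) * poly (Q t) x = G x t * poly Q' x"
      unfolding GPQ[OF x t] P'x[OF x] Q'x[OF x] using Qnz[OF x t] by (simp add: field_simps)
    finally have "((\<lambda>s. (b s * poly (P s) x - (G x s - G x t) * poly (Q s) x) * (1 / G x t)) has_vector_derivative
        G x t * poly Q' x * (1 / G x t)) (at t within I)"
      by (rule has_vector_derivative_mult_left)
    then have 1: "((\<lambda>s. (b s * poly (P s) x - (G x s - G x t) * poly (Q s) x) * (1 / G x t)) has_vector_derivative
        poly Q' x) (at t within I)" using Gt by simp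
    show ?thesis
      unfolding Q'_def[symmetric]
    proof (rule has_vector_derivative_transform[OF t _ 1])
      fix s assume s: "s \<in> I"
      have "b s * poly (P s) x = G x s * poly (Q s) x"
        using Qnz[OF x s] by (simp add: GPQ[OF x s])
      then show "(\<Prod>j\<in>J. x - \<zeta> j s) = (b s * poly (P s) x - (G x s - G x t) * poly (Q s) x) * (1 / G x t)"
        using Gt by (simp add: Q_def left_diff_distrib)
    qed
  qed
qed

text \<open>As \<open>a1 t\<close> is real, its product formula may be conjugated, which trades
  \<open>b * a1\<close> for |b|^2 times conjugated products. The result is the constant
  \<open>c\<close> of \<open>field_quotient_on_circle\<close>.\<close>

lemma A_infinity_eq:
  assumes q: "a1 t = b t * ((\<Prod>k=1..m. 0 - \<omega> k t) / (\<Prod>j=1..n. 0 - \<zeta> j t))" and a1: "cnj (a1 t) = a1 t"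
    and nz: "b t \<noteq> 0" "\<And>k. k \<in> {1..m} \<Longrightarrow> \<omega> k t \<noteq> 0" "\<And>j. j \<in> {1..n} \<Longrightarrow> \<zeta> j t \<noteq> 0"
  shows "A_infinity m n q b a1 t = (if card {1..m} = card {1..n}
    then of_real (q t) / of_real ((cmod (b t))\<^sup>2) * (\<Prod>j=1..n. - cnj (\<zeta> j t)) / (\<Prod>k=1..m. - cnj (\<omega> k t)) else 0)"
proof -
  define u where "u = (\<Prod>j=1..n. - \<zeta> j t)"
  define v where "v = (\<Prod>k=1..m. - \<omega> k t)"
  have nz': "u \<noteq> 0" "v \<noteq> 0" using nz by (auto simp: u_def v_def prod_zero_iff)
  have a: "a1 t = b t * (v / u)" using q by (simp add: u_def v_def)
  then have "cnj (b t) * (cnj v / cnj u) = a1 t" using a1 by simp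
  then have "cnj u / cnj v = cnj (b t) / a1 t"
    using nz(1) nz' by (metis complex_cnj_zero_iff divide_divide_eq_right nonzero_mult_div_cancel_left times_divide_eq_right)
  then have "of_real (q t) / of_real ((cmod (b t))\<^sup>2) * (cnj u / cnj v) = of_real (q t) / (b t * a1 t)"
    using nz(1) by (simp only: \<open>cnj u / cnj v = cnj (b t) / a1 t\<close> complex_norm_square) simp
  then show ?thesis by (auto simp: A_infinity_def u_def v_def)
qed

lemma prod_has_field_derivative:
  fixes z :: complex
  assumes "finite L" "\<And>k. k \<in> L \<Longrightarrow> z \<noteq> r k"
  shows "((\<lambda>z. \<Prod>k\<in>L. z - r k) has_field_derivative (\<Prod>k\<in>L. z - r k) * (\<Sum>k\<in>L. 1 / (z - r k))) (at z)"
  using poly_DERIV[of "root_poly L r" z] assms by (simp add: pderiv_root_poly poly_root_poly_var_eq)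

lemma rational_has_field_derivative:
  fixes z :: complex
  assumes fin: "finite K" "finite J" and z\<omega>: "\<And>k. k \<in> K \<Longrightarrow> z \<noteq> \<omega> k" and z\<zeta>: "\<And>j. j \<in> J \<Longrightarrow> z \<noteq> \<zeta> j"
  shows "((\<lambda>z. b * ((\<Prod>k\<in>K. z - \<omega> k) / (\<Prod>j\<in>J. z - \<zeta> j))) has_field_derivative
    b * ((\<Prod>k\<in>K. z - \<omega> k) / (\<Prod>j\<in>J. z - \<zeta> j)) * ((\<Sum>k\<in>K. 1 / (z - \<omega> k)) - (\<Sum>j\<in>J. 1 / (z - \<zeta> j)))) (at z)"
proof -
  have nz: "(\<Prod>j\<in>J. z - \<zeta> j) \<noteq> 0" using fin z\<zeta> by (simp add: prod_zero_iff)
  have "((\<lambda>z. b * ((\<Prod>k\<in>K. z - \<omega> k) / (\<Prod>j\<in>J. z - \<zeta> j))) has_field_derivative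
    b * (((\<Prod>k\<in>K. z - \<omega> k) * (\<Sum>k\<in>K. 1 / (z - \<omega> k)) * (\<Prod>j\<in>J. z - \<zeta> j)
      - (\<Prod>k\<in>K. z - \<omega> k) * ((\<Prod>j\<in>J. z - \<zeta> j) * (\<Sum>j\<in>J. 1 / (z - \<zeta> j)))) /
       ((\<Prod>j\<in>J. z - \<zeta> j) * (\<Prod>j\<in>J. z - \<zeta> j)))) (at z)"
    by (intro DERIV_cmult DERIV_divide prod_has_field_derivative fin nz) (use z\<omega> z\<zeta> in auto)
  moreover have "b * ((P * s * Q - P * (Q * r)) / (Q * Q)) = b * (P / Q) * (s - r)" if "Q \<noteq> 0" for P Q s r :: complex
    using that by (simp add: field_simps)
  ultimately show ?thesis using nz by simp
qed

theorem theorem3p2: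
  fixes I :: "real set" and q :: "real \<Rightarrow> real" and f :: "complex \<Rightarrow> real \<Rightarrow> complex"
    and m n :: nat and b :: "real \<Rightarrow> complex" and \<omega> \<zeta> :: "nat \<Rightarrow> real \<Rightarrow> complex"
  defines "A \<equiv> A_coeff m n q b \<omega> \<zeta>"
    and "A0 \<equiv> A_zero m n q b (\<lambda>t. space_deriv f 0 t) \<omega> \<zeta>"
  assumes sol: "locally_univalent_PG_solution I q f"
    and mn: "m \<ge> n"
    and g_form: "\<And>t z. t \<in> I \<Longrightarrow> z \<in> cball 0 1 \<Longrightarrow>
      space_deriv f z t = b t * ((\<Prod>k=1..m. z - \<omega> k t) / (\<Prod>j=1..n. z - \<zeta> j t))"
    and b_nz: "\<And>t. t \<in> I \<Longrightarrow> b t \<noteq> 0"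
    and zeros_cont: "\<And>k. k \<in> {1..m} \<Longrightarrow> continuous_on I (\<omega> k)"
    and poles_cont: "\<And>j. j \<in> {1..n} \<Longrightarrow> continuous_on I (\<zeta> j)"
    and zeros_out: "\<And>k t. k \<in> {1..m} \<Longrightarrow> t \<in> I \<Longrightarrow> cmod (\<omega> k t) > 1"
    and poles_out: "\<And>j t. j \<in> {1..n} \<Longrightarrow> t \<in> I \<Longrightarrow> cmod (\<zeta> j t) > 1"
    and no_cancel: "\<And>k j t. k \<in> {1..m} \<Longrightarrow> j \<in> {1..n} \<Longrightarrow> t \<in> I \<Longrightarrow> \<omega> k t \<noteq> \<zeta> j t"
    and simple_zeros: "\<And>k j t. k \<in> {1..m} \<Longrightarrow> j \<in> {1..m} \<Longrightarrow> k \<noteq> j \<Longrightarrow> t \<in> I \<Longrightarrow> \<omega> k t \<noteq> \<omega> j t"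
  shows "(\<forall>k\<in>{1..m}. has_log_deriv I (\<omega> k) (\<lambda>t. - (A0 t + 2 * A k t / \<omega> k t
            + (\<Sum>j\<in>{1..m} - {k}. 2 * (A k t + A j t) / (\<omega> k t - \<omega> j t))
            - (\<Sum>j=1..n. 2 * A k t / (\<omega> k t - \<zeta> j t))))) \<and>
         (\<forall>j\<in>{1..n}. has_log_deriv I (\<zeta> j) (\<lambda>t. - (A0 t
            + (\<Sum>k=1..m. 2 * A k t / (\<zeta> j t - \<omega> k t))))) \<and>
         has_log_deriv I b (\<lambda>t. of_nat (m - n + 1) * A0 t)"
proof -
  define K where "K = {1..m}"
  define J where "J = {1..n}"
  have fin: "finite K" "finite J" and cards: "card K = m" "card J = n" by (simp_all add: K_def J_def)
  define g where "g z t = space_deriv f z t" for z t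
  define p where "p t z = A0 t + (\<Sum>k\<in>K. 2 * A k t / (z - \<omega> k t))" for t z
  define W where "W t k = \<omega> k t * - (A0 t + 2 * A k t / \<omega> k t
            + (\<Sum>j\<in>K - {k}. 2 * (A k t + A j t) / (\<omega> k t - \<omega> j t))
            - (\<Sum>j\<in>J. 2 * A k t / (\<omega> k t - \<zeta> j t)))" for t k
  define V where "V t j = \<zeta> j t * - p t (\<zeta> j t)" for t j
  define B where "B t = (of_nat (card K) - of_nat (card J) + 1) * A0 t" for t
  have ti: "time_interval I" and smooth: "smooth_in_time I f" and qcont: "continuous_on I q"
    and ana: "\<And>t. t \<in> I \<Longrightarrow> (\<lambda>z. f z t) analytic_on cball 0 1"
    and a1: "\<And>t. t \<in> I \<Longrightarrow> cnj (space_deriv f 0 t) = space_deriv f 0 t"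
    using sol by (auto simp: locally_univalent_PG_solution_def Reals_cnj_iff)
  have intI: "is_interval I" using ti by (simp add: time_interval_def)
  have \<omega>1: "cmod (\<omega> k t) > 1" if "k \<in> K" "t \<in> I" for k t using zeros_out that by (simp add: K_def)
  have \<zeta>1: "cmod (\<zeta> j t) > 1" if "j \<in> J" "t \<in> I" for j t using poles_out that by (simp add: J_def)
  have \<omega>0: "\<omega> k t \<noteq> 0" if "k \<in> K" "t \<in> I" for k t using \<omega>1[OF that] by auto
  have \<zeta>0: "\<zeta> j t \<noteq> 0" if "j \<in> J" "t \<in> I" for j t using \<zeta>1[OF that] by auto
  have z\<omega>: "z \<noteq> \<omega> k t" if "k \<in> K" "t \<in> I" "cmod z \<le> 1" for z k t using \<omega>1[OF that(1,2)] that by auto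
  have z\<zeta>: "z \<noteq> \<zeta> j t" if "j \<in> J" "t \<in> I" "cmod z \<le> 1" for z j t using \<zeta>1[OF that(1,2)] that by auto
  have inj: "inj_on (\<lambda>k. \<omega> k t) K" if "t \<in> I" for t
    using simple_zeros[OF _ _ _ that] unfolding inj_on_def K_def by blast
  have nc: "\<omega> k t \<noteq> \<zeta> j t" if "k \<in> K" "j \<in> J" "t \<in> I" for k j t
    using no_cancel that by (simp add: K_def J_def)
  have cont\<omega>: "continuous_on I (\<omega> k)" if "k \<in> K" for k using zeros_cont that by (simp add: K_def)
  have cont\<zeta>: "continuous_on I (\<zeta> j)" if "j \<in> J" for j using poles_cont that by (simp add: J_def)
  have gform: "g z t = b t * ((\<Prod>k\<in>K. z - \<omega> k t) / (\<Prod>j\<in>J. z - \<zeta> j t))" if "t \<in> I" "cmod z \<le> 1" for z t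
    using g_form[of t z] that by (simp add: g_def K_def J_def)
  have A: "A k t = of_real (q t) / of_real ((cmod (b t))\<^sup>2) *
     (((\<Prod>j\<in>J. \<omega> k t - \<zeta> j t) * (\<Prod>j\<in>J. cnj (reflect (\<omega> k t) - \<zeta> j t))) /
      ((\<Prod>j\<in>K - {k}. \<omega> k t - \<omega> j t) * (\<Prod>j\<in>K. cnj (reflect (\<omega> k t) - \<omega> j t))))" for k t
    by (simp add: A_def A_coeff_def K_def J_def)
  define Ainf where "Ainf t = A_infinity m n q b (\<lambda>t. space_deriv f 0 t) t" for t
  have A0: "A0 t = Ainf t + (\<Sum>k\<in>K. A k t / \<omega> k t)" for t
    by (simp add: A0_def A_zero_def A_def Ainf_def K_def)
  have Ainf: "Ainf t = (if card K = card J then of_real (q t) / of_real ((cmod (b t))\<^sup>2) *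
      (\<Prod>j\<in>J. - cnj (\<zeta> j t)) / (\<Prod>k\<in>K. - cnj (\<omega> k t)) else 0)" if t: "t \<in> I" for t
    unfolding Ainf_def K_def J_def
    by (rule A_infinity_eq) (use g_form[OF t, of 0] a1[OF t] b_nz[OF t] \<omega>0 \<zeta>0 t in \<open>auto simp: K_def J_def\<close>)

  \<comment> \<open>Identification of the velocity of the given solution\<close>
  have velocity: "time_deriv I f z t = z * g z t * p t z" if t: "t \<in> I" and z: "z \<in> cball 0 1" for t z
    unfolding g_def
  proof (rule PG_velocity[OF sol t _ _ _ _ z])
    have nz: "z - \<omega> k t \<noteq> 0" if "k \<in> K" "z \<in> cball 0 1" for z k
      using z\<omega>[OF that(1) t, of z] that(2) by simp
    show "p t holomorphic_on ball 0 1"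
      unfolding p_def using nz by (intro holomorphic_intros) auto
    show "continuous_on (cball 0 1) (p t)"
      unfolding p_def by (intro continuous_intros) (use nz in auto)
    have quot: "Im (Ainf t - (\<Sum>k\<in>K. A k t / \<omega> k t)) = 0"
      "cmod z = 1 \<Longrightarrow> Re (Ainf t + (\<Sum>k\<in>K. A k t / \<omega> k t) + (\<Sum>k\<in>K. 2 * A k t / (z - \<omega> k t))) =
        Re (of_real (q t) / of_real ((cmod (b t))\<^sup>2) *
          complex_of_real ((\<Prod>j\<in>J. (cmod (z - \<zeta> j t))\<^sup>2) / (\<Prod>k\<in>K. (cmod (z - \<omega> k t))\<^sup>2)))" for z
      unfolding A Ainf[OF t]
      by (rule field_quotient_on_circle[where \<omega> = "\<lambda>k. \<omega> k t" and \<zeta> = "\<lambda>j. \<zeta> j t" and K = K and J = J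
            and q = "of_real (q t)" and \<beta> = "of_real ((cmod (b t))\<^sup>2)"];
          use fin inj[OF t] \<omega>1[OF _ t] \<zeta>1[OF _ t] mn cards in simp)+
    show "Re (p t z) = q t / (cmod (space_deriv f z t))\<^sup>2" if z: "cmod z = 1" for z
    proof -
      have "Re (p t z) = Re (of_real (q t) / of_real ((cmod (b t))\<^sup>2) *
          complex_of_real ((\<Prod>j\<in>J. (cmod (z - \<zeta> j t))\<^sup>2) / (\<Prod>k\<in>K. (cmod (z - \<omega> k t))\<^sup>2)))"
        unfolding p_def A0 by (rule quot(2)[OF z])
      also have "\<dots> = q t / (cmod (b t))\<^sup>2 * ((\<Prod>j\<in>J. (cmod (z - \<zeta> j t))\<^sup>2) / (\<Prod>k\<in>K. (cmod (z - \<omega> k t))\<^sup>2))"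
        by (simp only: of_real_divide[symmetric] of_real_mult[symmetric] Re_complex_of_real)
      also have "\<dots> = q t / (cmod (g z t))\<^sup>2"
        using z by (simp add: gform[OF t] norm_mult norm_divide power_mult_distrib power_divide
            prod_norm[symmetric] prod_power_distrib)
      finally show ?thesis by (simp add: g_def)
    qed
    \<comment> \<open>At 0 the doubled sum is minus twice the sum contained in \<open>A0\<close>, so
      the sign of that sum flips.\<close>
    have "p t 0 = Ainf t - (\<Sum>k\<in>K. A k t / \<omega> k t)"
      by (simp add: p_def A0 sum_negf sum_distrib_left[symmetric] times_divide_eq_right[symmetric] del: times_divide_eq_right)
    then show "Im (p t 0) = 0" using quot(1) by simp
  qed

  have gder: "(g z has_vector_derivative
      g z t * (B t - (\<Sum>k\<in>K. W t k / (z - \<omega> k t)) + (\<Sum>j\<in>J. V t j / (z - \<zeta> j t)))) (at t within I)"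
    if t: "t \<in> I" and z: "z \<in> ball 0 1" for t z
  proof -
    have z1: "cmod z \<le> 1" using z by simp
    define E where "E = (\<Sum>k\<in>K. 1 / (z - \<omega> k t)) - (\<Sum>j\<in>J. 1 / (z - \<zeta> j t))"
    define p' where "p' = - (\<Sum>k\<in>K. 2 * A k t / (z - \<omega> k t)\<^sup>2)"
    have ident: "z * p t z * E + (p t z - z * (\<Sum>k\<in>K. 2 * A k t / (z - \<omega> k t)\<^sup>2)) =
      (of_nat (card K) - of_nat (card J) + 1) * A0 t
      + (\<Sum>k\<in>K. \<omega> k t * (A0 t + 2 * A k t / \<omega> k t + (\<Sum>j\<in>K - {k}. 2 * (A k t + A j t) / (\<omega> k t - \<omega> j t))
           - (\<Sum>j\<in>J. 2 * A k t / (\<omega> k t - \<zeta> j t))) / (z - \<omega> k t))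
      - (\<Sum>j\<in>J. \<zeta> j t * p t (\<zeta> j t) / (z - \<zeta> j t))"
      unfolding E_def p_def
      by (rule log_time_derivative_identity[where \<omega> = "\<lambda>k. \<omega> k t" and \<zeta> = "\<lambda>j. \<zeta> j t" and A = "\<lambda>k. A k t"];
          use fin inj[OF t] nc[OF _ _ t] \<omega>0[OF _ t] z\<omega>[OF _ t z1] z\<zeta>[OF _ t z1] in simp)
    have "((\<lambda>z. b t * ((\<Prod>k\<in>K. z - \<omega> k t) / (\<Prod>j\<in>J. z - \<zeta> j t))) has_field_derivative g z t * E) (at z)"
      unfolding gform[OF t z1] E_def by (rule rational_has_field_derivative) (use fin z\<omega> z\<zeta> t z1 in auto)
    then have dg: "((\<lambda>z. g z t) has_field_derivative g z t * E) (at z)"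
      by (rule has_field_derivative_transform_within_open[OF _ open_ball z]) (simp add: gform[OF t])
    have "((\<lambda>z. 2 * A k t / (z - \<omega> k t)) has_field_derivative - (2 * A k t / (z - \<omega> k t)\<^sup>2)) (at z)" if "k \<in> K" for k
      using z\<omega>[OF that t z1] by (auto intro!: derivative_eq_intros simp: power2_eq_square)
    then have dp: "(p t has_field_derivative p') (at z)"
      unfolding p_def p'_def sum_negf[symmetric]
      by (intro DERIV_cong[OF DERIV_add[OF DERIV_const DERIV_sum]]) auto
    have "((\<lambda>z. z * g z t * p t z) has_field_derivative (1 * g z t + g z t * E * z) * p t z + p' * (z * g z t)) (at z)"
      by (intro DERIV_mult DERIV_ident dg dp)
    then have "((\<lambda>w. time_deriv I f w t) has_field_derivative (1 * g z t + g z t * E * z) * p t z + p' * (z * g z t)) (at z)"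
      by (rule has_field_derivative_transform_within_open[OF _ open_ball z]) (simp add: velocity[OF t])
    then have "deriv (\<lambda>w. time_deriv I f w t) z = g z t * (z * p t z * E + (p t z + z * p'))"
      by (simp add: DERIV_imp_deriv algebra_simps)
    also have "z * p t z * E + (p t z + z * p') =
        B t - (\<Sum>k\<in>K. W t k / (z - \<omega> k t)) + (\<Sum>j\<in>J. V t j / (z - \<zeta> j t))"
      using ident
      unfolding p'_def W_def V_def B_def mult_minus_right minus_divide_left[symmetric] sum_negf by simp
    finally show ?thesis
      using time_deriv_holomorphic(2)[OF ti t smooth ana z] by (simp add: g_def[abs_def])
  qed

  \<comment> \<open>Derivatives of the leading factor, the zeros and the poles\<close>
  have X: "infinite (ball (0::complex) 1)"
    using uncountable_ball[of 1 "0 :: complex"] countable_finite by auto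
  have rm: "(b has_vector_derivative b t * B t) (at t within I)"
    "\<And>k. k \<in> K \<Longrightarrow> (\<omega> k has_vector_derivative W t k) (at t within I)"
    "\<And>x. x \<in> ball 0 1 \<Longrightarrow> ((\<lambda>s. \<Prod>j\<in>J. x - \<zeta> j s) has_vector_derivative
        poly (root_poly_var J (\<lambda>j. \<zeta> j t) (V t)) x) (at t within I)" if t: "t \<in> I" for t
  proof -
    have G: "g x s = b s * ((\<Prod>k\<in>K. x - \<omega> k s) / (\<Prod>j\<in>J. x - \<zeta> j s))" if "x \<in> ball 0 1" "s \<in> I" for x s
      using that by (intro gform) auto
    have X\<omega>: "x \<noteq> \<omega> k t" if "x \<in> ball 0 1" "k \<in> K" for x k
      using that by (intro z\<omega> t) auto
    have X\<zeta>: "x \<noteq> \<zeta> j s" if "x \<in> ball 0 1" "j \<in> J" "s \<in> I" for x j s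
      using that by (intro z\<zeta>) auto
    have c: "continuous (at t within I) (\<omega> k)" if "k \<in> K" for k
      using cont\<omega>[OF that] t by (simp add: continuous_on_eq_continuous_within)
    have c': "continuous (at t within I) (\<zeta> j)" if "j \<in> J" for j
      using cont\<zeta>[OF that] t by (simp add: continuous_on_eq_continuous_within)
    note rm = rational_motion[OF fin t X G X\<omega> X\<zeta> c c' b_nz[OF t] inj[OF t] nc[OF _ _ t] gder[OF t]]
    show "(b has_vector_derivative b t * B t) (at t within I)"
      by (rule rm(1))
    show "(\<omega> k has_vector_derivative W t k) (at t within I)" if "k \<in> K" for k
      by (rule rm(2); (assumption | rule that))
    show "((\<lambda>s. \<Prod>j\<in>J. x - \<zeta> j s) has_vector_derivative
        poly (root_poly_var J (\<lambda>j. \<zeta> j t) (V t)) x) (at t within I)" if "x \<in> ball 0 1" for x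
      by (rule rm(3); (assumption | rule that))
  qed

  \<comment> \<open>\<open>roots_has_vector_derivative\<close> needs velocities continuous in time.
    Those of the poles involve \<open>b\<close> through \<open>A\<close>, and continuity of
    \<open>b\<close> becomes available only with its derivative.\<close>
  have contb: "continuous_on I b"
    unfolding continuous_on_eq_continuous_within by (intro ballI has_vector_derivative_continuous[OF rm(1)])
  have contA: "continuous_on I (A k)" if k: "k \<in> K" for k
  proof -
    have "reflect (\<omega> k t) \<noteq> \<omega> j t" if "j \<in> K" "t \<in> I" for j t
      using \<omega>1[OF k that(2)] by (intro z\<omega>[OF that]) (simp add: reflect_def norm_divide divide_simps)
    then have 1: "(\<Prod>j\<in>K. cnj (reflect (\<omega> k t) - \<omega> j t)) \<noteq> 0" if "t \<in> I" for t
      using fin that by (auto simp: prod_zero_iff)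
    have 2: "(\<Prod>j\<in>K - {k}. \<omega> k t - \<omega> j t) \<noteq> 0" if "t \<in> I" for t
      using fin inj_onD[OF inj[OF that], of k] k by (auto simp: prod_zero_iff)
    have 3: "continuous_on I (\<lambda>t. reflect (\<omega> k t))"
      unfolding reflect_def by (intro continuous_intros cont\<omega> k) (use \<omega>0 k in auto)
    have "continuous_on I (\<lambda>t. of_real (q t) / of_real ((cmod (b t))\<^sup>2) *
     (((\<Prod>j\<in>J. \<omega> k t - \<zeta> j t) * (\<Prod>j\<in>J. cnj (reflect (\<omega> k t) - \<zeta> j t))) /
      ((\<Prod>j\<in>K - {k}. \<omega> k t - \<omega> j t) * (\<Prod>j\<in>K. cnj (reflect (\<omega> k t) - \<omega> j t)))))"
      by (intro continuous_intros qcont contb cont\<omega> cont\<zeta> 3 k) (use 1 2 b_nz in auto)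
    then show ?thesis by (simp add: A[abs_def])
  qed
  have "continuous_on I Ainf"
  proof -
    have nz: "(\<Prod>k\<in>K. - cnj (\<omega> k t)) \<noteq> 0" if "t \<in> I" for t
      using fin \<omega>0 that by (auto simp: prod_zero_iff)
    have "continuous_on I (\<lambda>t. of_real (q t) / of_real ((cmod (b t))\<^sup>2) *
      (\<Prod>j\<in>J. - cnj (\<zeta> j t)) / (\<Prod>k\<in>K. - cnj (\<omega> k t)))"
      by (intro continuous_intros qcont contb cont\<omega> cont\<zeta>) (use nz b_nz in auto)
    then have "continuous_on I (\<lambda>t. if card K = card J then of_real (q t) / of_real ((cmod (b t))\<^sup>2) *
      (\<Prod>j\<in>J. - cnj (\<zeta> j t)) / (\<Prod>k\<in>K. - cnj (\<omega> k t)) else 0)"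
      by (cases "card K = card J") simp_all
    then show ?thesis by (rule continuous_on_eq) (simp add: Ainf)
  qed
  then have contA0: "continuous_on I A0"
    unfolding A0[abs_def] by (intro continuous_intros contA cont\<omega>) (use \<omega>0 in auto)
  have contV: "continuous_on I (\<lambda>t. V t j)" if j: "j \<in> J" for j
  proof -
    have "\<forall>t\<in>I. \<zeta> j t - \<omega> k t \<noteq> 0" if "k \<in> K" for k using nc[OF that j] by fastforce
    then show ?thesis
      unfolding V_def p_def by (intro continuous_intros contA contA0 cont\<omega> cont\<zeta> j)
  qed
  \<comment> \<open>\<open>V t j\<close> depends on \<open>j\<close> only through the position of
    the pole, so coinciding poles have equal velocities, as assumption \<open>eq\<close> of the root
    lemma demands.\<close>
  have \<zeta>d: "(\<zeta> j has_vector_derivative V t j) (at t within I)" if "j \<in> J" "t \<in> I" for j t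
    by (rule roots_has_vector_derivative[OF intI that(2) fin(2) that(1) cont\<zeta> contV X rm(3)])
      (auto simp: V_def)

  show ?thesis
  proof (intro conjI ballI)
    fix k assume k: "k \<in> {1..m}"
    show "has_log_deriv I (\<omega> k) (\<lambda>t. - (A0 t + 2 * A k t / \<omega> k t
            + (\<Sum>j\<in>{1..m} - {k}. 2 * (A k t + A j t) / (\<omega> k t - \<omega> j t))
            - (\<Sum>j=1..n. 2 * A k t / (\<omega> k t - \<zeta> j t))))"
      using rm(2) k \<omega>0 unfolding W_def K_def J_def
      by (intro has_log_deriv_if_has_vector_derivative[OF intI]) auto
  next
    fix j assume j: "j \<in> {1..n}"
    show "has_log_deriv I (\<zeta> j) (\<lambda>t. - (A0 t + (\<Sum>k=1..m. 2 * A k t / (\<zeta> j t - \<omega> k t))))"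
      using \<zeta>d j \<zeta>0 unfolding V_def p_def K_def J_def
      by (intro has_log_deriv_if_has_vector_derivative[OF intI]) auto
  next
    have "B t = of_nat (m - n + 1) * A0 t" for t
      using mn by (simp add: B_def cards of_nat_diff)
    then show "has_log_deriv I b (\<lambda>t. of_nat (m - n + 1) * A0 t)"
      using rm(1) b_nz by (intro has_log_deriv_if_has_vector_derivative[OF intI]) auto
  qed
qed

end
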